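(* Let $\Gamma$ be the group of homeomorphisms of $\mathbb{R}$ constructed as described in the context (for any choice of the elements $t_{i+1}$). Then $\Gamma$ has commuting $\mathbb{Z}$-conjugates, but $\Gamma$ is not dissipated (in fact, $\Gamma$ is not even binate) and $\Gamma$ does not have conjugates in commuting $\mathbb{Z}$-conjugate.
   Context: Notation: ${}^t g = t g t^{-1}$, ${}^tH = tHt^{-1}$; $\mathrm{supp}(g) = \{x : g(x) \neq x\}$; the support of a group is the union of the supports of its elements; $\mathrm{Homeo}_c(\mathbb{R})$ is the group of compactly supported homeomorphisms of $\mathbb{R}$. *Construction.* Let $I_1 = (0,1)$ and let $\Gamma_1 = G_1$ be the copy of Thompson's group $F$ (which is finitely generated) acting in the standard way, hence minimally (all orbits dense), on $I_1$ and fixing the complement of $I_1$ pointwise. Inductively, suppose given a group $G_i \leq \mathrm{Homeo}_c(\mathbb{R})$ supported on an interval $I_i$ and a finitely generated subgroup $\Gamma_i \leq G_i$. Choose $t_{i+1} \in \mathrm{Homeo}_c(\mathbb{R})$ with connected support such that $t_{i+1}(I_i) \cap I_i = \emptyset$. Put $I_i^p = t_{i+1}^p(I_i)$ for $p \in \mathbb{Z}$; these intervals are pairwise disjoint. Let $G_i^\omega$ be the group of all homeomorphisms $g$ supported on $\bigsqcup_{p \in \mathbb{Z}} I_i^p$ such that for each $p$ the restriction of $g$ to $I_i^p$ coincides with the restriction of some element of ${}^{t_{i+1}^p} G_i$ (so $G_i^\omega \cong \prod_{\mathbb{Z}} G_i$). Set $G_{i+1} = \langle G_i^\omega, t_{i+1}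 \rangle$ (isomorphic to the unrestricted wreath product of $G_i$ by $\mathbb{Z}$), $\Gamma_{i+1} = \langle \Gamma_i, t_{i+1} \rangle$ (isomorphic to the restricted wreath product $\Gamma_i \wr \mathbb{Z}$), and $I_{i+1} = \mathrm{supp}(t_{i+1}) = \mathrm{supp}(\Gamma_{i+1}) = \mathrm{supp}(G_{i+1})$. Let $\Gamma = \bigcup_i \Gamma_i$ and $G = \bigcup_i G_i$. *Commuting $\mathbb{Z}$-conjugates.* A group $\Delta$ has this property if for every finitely generated subgroup $H \leq \Delta$ there exists $t \in \Delta$ such that $[H, {}^{t^p} H] = 1$ for all integers $p \geq 1$. *Binate.* A group $\Delta$ is binate if for every finitely generated subgroup $H \leq \Delta$ there exist a homomorphism $f \colon H \to \Delta$ with $[H, f(H)] = 1$ and an element $t \in \Delta$ such that ${}^t f(h) = h \cdot f(h)$ for all $h \in H$. *Dissipated.* Let $X$ be a set written as a directed union of a direct system of subsets $(X_i)_{i \in I}$ and let $\Delta$ be a group of bijections of $X$ that is boundedly supported, i.e. every $g \in \Delta$ satisfies $\mathrm{supp}(g) \subset X_i$ for some $i$. A *dissipator* for $\Delta$ and $X_i$ is an element $t_i \in \Delta$ such that (1) $t_i^p(X_i) \cap X_i = \emptyset$ for all $p \geq 1$; (2) for every $g \in \Delta$ supported on $X_i$, the bijection $f(g)$ which equals ${}^{t_i^p} g$ on $t_i^p(X_i)$ for every $p \geq 1$ and equals the identity elsewhere belongs to $\Delta$. The group $\Delta$ is *dissipated* if there is a dissipator for $\Delta$ and $X_i$ for every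 $i \in I$. An abstract group is called dissipated if it can be realised as such a group of bijections for some set $X$ and some system $(X_i)_{i\in I}$. *Conjugates in commuting $\mathbb{Z}$-conjugate.* A group $\Delta$ has this property if there exist a subgroup $\Lambda \leq \Delta$ and $t \in \Delta$ such that (1) $[\Lambda, {}^{t^p}\Lambda] = 1$ for all integers $p \geq 1$; (2) every finite subset of $\Delta$ is contained in a conjugate of $\Lambda$ in $\Delta$. *)

theory Defs
  imports "HOL-Analysis.Analysis" "HOL-Algebra.Bij" "HOL-Algebra.Generated_Groups"
begin

section \<open>Group-theoretic notions\<close>

definition conj_by :: "('a, 'b) monoid_scheme \<Rightarrow> 'a \<Rightarrow> 'a \<Rightarrow> 'a" where
  "conj_by G t g = t \<otimes>\<^bsub>G\<^esub> g \<otimes>\<^bsub>G\<^esub> inv\<^bsub>G\<^esub> t"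

text \<open>The two-argument version of \<^const>\<open>derived\<close>.\<close>
definition commutator_subgroup :: "('a, 'b) monoid_scheme \<Rightarrow> 'a set \<Rightarrow> 'a set \<Rightarrow> 'a set" where
  "commutator_subgroup G H K =
     generate G (\<Union>h\<in>H. \<Union>k\<in>K. {h \<otimes>\<^bsub>G\<^esub> k \<otimes>\<^bsub>G\<^esub> inv\<^bsub>G\<^esub> h \<otimes>\<^bsub>G\<^esub> inv\<^bsub>G\<^esub> k})"

definition fin_gen_subgroup :: "'a set \<Rightarrow> ('a, 'b) monoid_scheme \<Rightarrow> bool" where
  "fin_gen_subgroup H G \<longleftrightarrow> (\<exists>S. finite S \<and> S \<subseteq> carrier G \<and> H = generate G S)"

definition commuting_Z_conjugates :: "('a, 'b) monoid_scheme \<Rightarrow> bool" where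
  "commuting_Z_conjugates G \<longleftrightarrow>
     (\<forall>H. fin_gen_subgroup H G \<longrightarrow>
        (\<exists>t\<in>carrier G. \<forall>p::int. p \<ge> 1 \<longrightarrow>
           commutator_subgroup G H (conj_by G (t [^]\<^bsub>G\<^esub> p) ` H) = {\<one>\<^bsub>G\<^esub>}))"

definition binate :: "('a, 'b) monoid_scheme \<Rightarrow> bool" where
  "binate G \<longleftrightarrow>
     (\<forall>H. fin_gen_subgroup H G \<longrightarrow>
        (\<exists>f \<in> hom (G\<lparr>carrier := H\<rparr>) G.
           commutator_subgroup G H (f ` H) = {\<one>\<^bsub>G\<^esub>} \<and>
           (\<exists>t\<in>carrier G. \<forall>h\<in>H. conj_by G t (f h) = h \<otimes>\<^bsub>G\<^esub> f h)))"

definition conjugates_in_commuting_Z_conjugate :: "('a, 'b) monoid_scheme \<Rightarrow> bool" where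
  "conjugates_in_commuting_Z_conjugate G \<longleftrightarrow>
     (\<exists>\<Lambda> t. subgroup \<Lambda> G \<and> t \<in> carrier G \<and>
        (\<forall>p::int. p \<ge> 1 \<longrightarrow>
           commutator_subgroup G \<Lambda> (conj_by G (t [^]\<^bsub>G\<^esub> p) ` \<Lambda>) = {\<one>\<^bsub>G\<^esub>}) \<and>
        (\<forall>F. finite F \<and> F \<subseteq> carrier G \<longrightarrow> (\<exists>g\<in>carrier G. F \<subseteq> conj_by G g ` \<Lambda>)))"


section \<open>Dissipated groups\<close>

definition supp_on :: "'x set \<Rightarrow> ('x \<Rightarrow> 'x) \<Rightarrow> 'x set" where
  "supp_on X g = {x \<in> X. g x \<noteq> x}"

definition directed_union ::
  "'x set \<Rightarrow> 'i set \<Rightarrow> ('i \<Rightarrow> 'i \<Rightarrow> bool) \<Rightarrow> ('i \<Rightarrow> 'x set) \<Rightarrow> bool" where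
  "directed_union X I preceq Xs \<longleftrightarrow>
     I \<noteq> {} \<and>
     (\<forall>i\<in>I. preceq i i) \<and>
     (\<forall>i\<in>I. \<forall>j\<in>I. \<forall>k\<in>I. preceq i j \<longrightarrow> preceq j k \<longrightarrow> preceq i k) \<and>
     (\<forall>i\<in>I. \<forall>j\<in>I. \<exists>k\<in>I. preceq i k \<and> preceq j k) \<and>
     (\<forall>i\<in>I. \<forall>j\<in>I. preceq i j \<longrightarrow> Xs i \<subseteq> Xs j) \<and>
     X = (\<Union>i\<in>I. Xs i)"

text \<open>
  In the second clause \<open>f\<close> is the bijection \<open>f(g)\<close>; the values prescribed on the translates
  of \<open>Y\<close> are consistent because the first clause makes these translates pairwise disjoint.
\<close>
definition dissipator :: "'x set \<Rightarrow> ('x \<Rightarrow> 'x) set \<Rightarrow> 'x set \<Rightarrow> ('x \<Rightarrow> 'x) \<Rightarrow> bool" where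
  "dissipator X D Y t \<longleftrightarrow>
     t \<in> D \<and>
     (\<forall>p::int. p \<ge> 1 \<longrightarrow> (t [^]\<^bsub>BijGroup X\<^esub> p) ` Y \<inter> Y = {}) \<and>
     (\<forall>g\<in>D. supp_on X g \<subseteq> Y \<longrightarrow>
        (\<exists>f\<in>D.
           (\<forall>p::int. p \<ge> 1 \<longrightarrow>
              (\<forall>x \<in> (t [^]\<^bsub>BijGroup X\<^esub> p) ` Y.
                 f x = conj_by (BijGroup X) (t [^]\<^bsub>BijGroup X\<^esub> p) g x)) \<and>
           (\<forall>x \<in> X - (\<Union>p\<in>{1::int..}. (t [^]\<^bsub>BijGroup X\<^esub> p) ` Y). f x = x)))"

definition dissipated_action ::
  "'x set \<Rightarrow> 'i set \<Rightarrow> ('i \<Rightarrow> 'i \<Rightarrow> bool) \<Rightarrow> ('i \<Rightarrow> 'x set) \<Rightarrow> ('x \<Rightarrow> 'x) set \<Rightarrow> bool" where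
  "dissipated_action X I preceq Xs D \<longleftrightarrow>
     directed_union X I preceq Xs \<and>
     subgroup D (BijGroup X) \<and>
     (\<forall>g\<in>D. \<exists>i\<in>I. supp_on X g \<subseteq> Xs i) \<and>
     (\<forall>i\<in>I. \<exists>t. dissipator X D (Xs i) t)"

text \<open>
  HOL cannot quantify over types inside a formula, so the types from which the set \<open>X\<close> and
  the index set are taken are parameters.  A group is not dissipated iff
  \<open>\<not> dissipated TYPE('x) TYPE('i) G\<close> holds for all \<open>'x\<close> and \<open>'i\<close>.
\<close>
definition dissipated :: "'x itself \<Rightarrow> 'i itself \<Rightarrow> ('a, 'b) monoid_scheme \<Rightarrow> bool" where
  "dissipated TX TI G \<longleftrightarrow>
     (\<exists>(X :: 'x set) (I :: 'i set) preceq Xs D.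
        dissipated_action X I preceq Xs D \<and> G \<cong> (BijGroup X)\<lparr>carrier := D\<rparr>)"


section \<open>The construction\<close>

definition Homeo_c :: "(real \<Rightarrow> real) set" where
  "Homeo_c = {g. (\<exists>g'. homeomorphism UNIV UNIV g g') \<and> compact (closure (supp_on UNIV g))}"

definition dyadic_rationals :: "real set" where
  "dyadic_rationals = {real_of_int a / 2 ^ n | a n. True}"

text \<open>
  Thompson's group \<open>F\<close> on \<open>(0,1)\<close>, extended by the identity: away from finitely many dyadic
  breakpoints, elements are locally affine with slope an integral power of 2.
\<close>
definition Thompson_F :: "(real \<Rightarrow> real) set" where
  "Thompson_F =
     {g. (\<exists>g'. homeomorphism UNIV UNIV g g') \<and> supp_on UNIV g \<subseteq> {0<..<1} \<and>
         (\<exists>B. finite B \<and> B \<subseteq> dyadic_rationals \<and>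
            (\<forall>a b. {a<..<b} \<subseteq> {0<..<1} - B \<longrightarrow>
               (\<exists>(k::int) c. \<forall>x\<in>{a<..<b}. g x = 2 powi k * x + c)))}"

text \<open>
  Stages are numbered from 0, so stage \<open>n\<close> here is stage \<open>n + 1\<close> in the usual numbering;
  \<open>t (Suc n)\<close> is the element used to pass from stage \<open>n\<close> to stage \<open>Suc n\<close>, and \<open>t 0\<close> is unused.
\<close>
primrec stage_interval :: "(nat \<Rightarrow> real \<Rightarrow> real) \<Rightarrow> nat \<Rightarrow> real set" where
  "stage_interval t 0 = {0<..<1}"
| "stage_interval t (Suc n) = supp_on UNIV (t (Suc n))"

primrec stage_Gamma :: "(nat \<Rightarrow> real \<Rightarrow> real) \<Rightarrow> nat \<Rightarrow> (real \<Rightarrow> real) set" where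
  "stage_Gamma t 0 = Thompson_F"
| "stage_Gamma t (Suc n) = generate (BijGroup UNIV) (insert (t (Suc n)) (stage_Gamma t n))"

definition admissible_choice :: "(nat \<Rightarrow> real \<Rightarrow> real) \<Rightarrow> bool" where
  "admissible_choice t \<longleftrightarrow>
     (\<forall>n. t (Suc n) \<in> Homeo_c \<and> connected (supp_on UNIV (t (Suc n))) \<and>
          t (Suc n) ` stage_interval t n \<inter> stage_interval t n = {})"

definition Gamma_group :: "(nat \<Rightarrow> real \<Rightarrow> real) \<Rightarrow> (real \<Rightarrow> real) monoid" where
  "Gamma_group t = (BijGroup UNIV)\<lparr>carrier := \<Union>n. stage_Gamma t n\<rparr>"

end

theory Submission
  imports Defs "HOL-Library.Groups_Big_Fun"
begin

text \<open>
  In a binate or dissipated group every element \<open>h\<close> is a commutator, because some \<open>f\<close> is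
  conjugate to \<open>h f\<close>.  The group \<open>\<Gamma>\<close> is not perfect: the logarithm of the slope at \<open>0\<close> is a
  homomorphism on Thompson's group, and it extends through each wreath product by summing it over
  the coordinates.  A single element of Thompson's group with slope \<open>1/2\<close> at \<open>0\<close> therefore
  excludes both properties.

  For conjugates in commuting \<open>\<int>\<close>-conjugate, let the given element \<open>u\<close> lie in \<open>\<Gamma>\<^sub>n\<close>, and let \<open>v\<close> be
  any conjugate of \<open>u\<close> in \<open>\<Gamma>\<close>.  The support of \<open>v\<close> lies in a translate of \<open>I\<^sub>n\<close>, which is either
  disjoint from \<open>I\<^sub>n\<^sub>+\<^sub>1\<close> or one of the intervals \<open>\<tau>\<^sup>k(I\<^sub>n)\<close> with \<open>\<tau> = t\<^sub>n\<^sub>+\<^sub>1\<close>.  In both cases, if \<open>\<tau>\<close>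
  commutes with its conjugate by \<open>v\<close>, then it commutes with \<open>v\<close>.  So a conjugate of \<open>\<Lambda>\<close> containing
  \<open>\<tau>\<close> and a nontrivial element of Thompson's group would force these two to commute.
\<close>

section \<open>Permutations and supports\<close>

abbreviation Sym :: "('x \<Rightarrow> 'x) monoid" where
  "Sym \<equiv> BijGroup UNIV"

abbreviation finv :: "('x \<Rightarrow> 'x) \<Rightarrow> 'x \<Rightarrow> 'x" where
  "finv \<equiv> inv_into UNIV"

lemma carrier_Sym: "carrier Sym = {f. bij f}"
  by (auto simp: BijGroup_def Bij_def)

lemma mult_Sym: "bij f \<Longrightarrow> bij g \<Longrightarrow> f \<otimes>\<^bsub>Sym\<^esub> g = f \<circ> g"
  by (auto simp: BijGroup_def Bij_def compose_def fun_eq_iff)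

lemma one_Sym [simp]: "\<one>\<^bsub>Sym\<^esub> = id"
  by (auto simp: BijGroup_def)

lemma inv_Sym: "bij f \<Longrightarrow> inv\<^bsub>Sym\<^esub> f = finv f"
  by (subst inv_BijGroup) (auto simp: Bij_def inv_into_def)

lemma group_Sym: "group (Sym :: ('x \<Rightarrow> 'x) monoid)"
  by (rule group_BijGroup)

lemma subgroup_SymI:
  assumes "\<And>f. f \<in> H \<Longrightarrow> bij f" "id \<in> H"
    and "\<And>f g. f \<in> H \<Longrightarrow> g \<in> H \<Longrightarrow> f \<circ> g \<in> H" "\<And>f. f \<in> H \<Longrightarrow> finv f \<in> H"
  shows "subgroup H Sym"
proof
  show "H \<subseteq> carrier Sym"
    using assms(1) by (auto simp: carrier_Sym)
  show "inv\<^bsub>Sym\<^esub> f \<in> H" if "f \<in> H" for f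
    using assms(1,4)[OF that] by (simp add: inv_Sym)
qed (use assms in \<open>auto simp: mult_Sym one_Sym\<close>)

lemma subgroup_SymD:
  assumes "subgroup H Sym"
  shows "f \<in> H \<Longrightarrow> bij f" "id \<in> H" "f \<in> H \<Longrightarrow> g \<in> H \<Longrightarrow> f \<circ> g \<in> H" "f \<in> H \<Longrightarrow> finv f \<in> H"
  using subgroup.mem_carrier[OF assms] subgroup.one_closed[OF assms]
    subgroup.m_closed[OF assms, of f g] subgroup.m_inv_closed[OF assms, of f]
  by (auto simp: carrier_Sym one_Sym mult_Sym inv_Sym)

section \<open>Integer powers of a permutation\<close>

abbreviation zpow :: "('x \<Rightarrow> 'x) \<Rightarrow> int \<Rightarrow> 'x \<Rightarrow> 'x" where
  "zpow f p \<equiv> f [^]\<^bsub>Sym\<^esub> p"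

lemma bij_zpow: "bij f \<Longrightarrow> bij (zpow f p)"
  using group.int_pow_closed[OF group_Sym, of f p] by (simp add: carrier_Sym)

lemma zpow_add: "bij f \<Longrightarrow> zpow f (p + q) x = zpow f p (zpow f q x)"
  using group.int_pow_mult[OF group_Sym, of f p q] by (simp add: carrier_Sym mult_Sym bij_zpow)

lemma zpow_1 [simp]: "bij f \<Longrightarrow> zpow f 1 = f"
  by (simp add: group.int_pow_1[OF group_Sym] carrier_Sym)

lemma zpow_minus [simp]: "bij f \<Longrightarrow> zpow f (- p) (zpow f p x) = x" "bij f \<Longrightarrow> zpow f p (zpow f (- p) x) = x"
  using zpow_add[of f "-p" p x] zpow_add[of f p "-p" x] by simp_all

lemma zpow_Suc: "bij f \<Longrightarrow> zpow f (p + 1) x = zpow f p (f x)" "bij f \<Longrightarrow> zpow f (1 + p) x = f (zpow f p x)"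
  using zpow_add[of f p 1 x] zpow_add[of f 1 p x] by simp_all

lemma zpow_eq_iff [simp]: "bij f \<Longrightarrow> zpow f p x = zpow f p y \<longleftrightarrow> x = y"
  using bij_zpow[of f p] by (simp add: bij_is_inj inj_eq)

section \<open>Supports and disjointly supported permutations\<close>

abbreviation supp :: "('x \<Rightarrow> 'x) \<Rightarrow> 'x set" where
  "supp g \<equiv> supp_on UNIV g"

lemma mem_supp: "x \<in> supp g \<longleftrightarrow> g x \<noteq> x"
  by (simp add: supp_on_def)

lemma supp_subset_iff: "supp g \<subseteq> A \<longleftrightarrow> (\<forall>x. x \<notin> A \<longrightarrow> g x = x)"
  by (auto simp: supp_on_def)

lemma supp_image:
  assumes "inj g" "supp g \<subseteq> A" "x \<in> A"
  shows "g x \<in> A"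
  using assms unfolding supp_subset_iff by (metis injD)

lemma supp_inv: "bij g \<Longrightarrow> supp g \<subseteq> A \<Longrightarrow> supp (finv g) \<subseteq> A"
  unfolding supp_subset_iff by (metis bij_inv_eq_iff)

lemma supp_comp: "supp f \<subseteq> A \<Longrightarrow> supp g \<subseteq> A \<Longrightarrow> supp (f \<circ> g) \<subseteq> A"
  unfolding supp_subset_iff by simp

lemma supp_conj:
  assumes "bij f" "supp g \<subseteq> A"
  shows "supp (f \<circ> g \<circ> finv f) \<subseteq> f ` A"
  using assms unfolding supp_subset_iff
  by (metis bij_inv_eq_iff comp_apply imageI)

lemma disjoint_supp_commute:
  assumes "bij f" "bij g" "supp f \<subseteq> A" "supp g \<subseteq> B" "A \<inter> B = {}"
  shows "f \<circ> g = g \<circ> f"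
proof
  fix x
  consider "x \<in> A" | "x \<in> B" | "x \<notin> A" "x \<notin> B"
    by blast
  then show "(f \<circ> g) x = (g \<circ> f) x"
  proof cases
    case 1
    then have "f x \<in> A"
      using assms bij_is_inj supp_image by metis
    with 1 assms(4,5) have "g x = x" "g (f x) = f x"
      unfolding supp_subset_iff by blast+
    then show ?thesis
      by simp
  next
    case 2
    then have "g x \<in> B"
      using assms bij_is_inj supp_image by metis
    with 2 assms(3,5) have "f x = x" "f (g x) = g x"
      unfolding supp_subset_iff by blast+
    then show ?thesis
      by simp
  next
    case 3
    with assms show ?thesis
      unfolding supp_subset_iff by auto
  qed
qed

lemma subgroup_supported: "subgroup {g. bij g \<and> supp g \<subseteq> A} Sym"
  by (rule subgroup_SymI) (auto simp: bij_comp bij_imp_bij_inv dest: supp_inv supp_comp,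
      auto simp: supp_on_def)


section \<open>Restricted wreath products acting on a union of translates\<close>

text \<open>One step of the construction without topology: \<open>E\<close> is the group of the
  current stage, \<open>I\<close> contains its support and \<open>\<tau>\<close> is the next
  translating element. The assumptions are such that \<open>wreath\<close> can serve as
  \<open>E\<close> one stage later.\<close>

locale wandering =
  fixes I :: "'x set" and \<tau> :: "'x \<Rightarrow> 'x" and E :: "('x \<Rightarrow> 'x) set"
  assumes bij: "bij \<tau>" and nonempty: "I \<noteq> {}"
    and disjoint: "p \<noteq> 0 \<Longrightarrow> zpow \<tau> p ` I \<inter> I = {}"
    and subgroup: "subgroup E Sym"
    and supported: "g \<in> E \<Longrightarrow> supp g \<subseteq> I"
begin

text \<open>Wreath product coordinates. The blocks are the translates of \<open>I\<close> by powers
  of \<open>\<tau>\<close>; \<open>k\<close> shifts their indices, and \<open>c p\<close> is the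
  action on block \<open>p\<close> read back in \<open>I\<close>, before the shift. Finiteness makes
  the product restricted.\<close>

definition coords :: "('x \<Rightarrow> 'x) \<Rightarrow> int \<Rightarrow> (int \<Rightarrow> 'x \<Rightarrow> 'x) \<Rightarrow> bool" where
  "coords g k c \<longleftrightarrow> (\<forall>p. c p \<in> E) \<and> finite {p. c p \<noteq> id} \<and>
     (\<forall>p. \<forall>x\<in>I. g (zpow \<tau> p x) = zpow \<tau> (p + k) (c p x))"

text \<open>Only the action on the blocks is prescribed; an element is free elsewhere in
  \<open>supp \<tau>\<close>. The coordinates are still well defined, and the bound on the support
  matches the interval of the next stage.\<close>

definition wreath :: "('x \<Rightarrow> 'x) set" where
  "wreath = {g. bij g \<and> supp g \<subseteq> supp \<tau> \<and> (\<exists>k c. coords g k c)}"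

lemmas E_group = subgroup_SymD[OF subgroup]

lemma E_maps: "g \<in> E \<Longrightarrow> x \<in> I \<Longrightarrow> g x \<in> I"
  using supp_image[OF _ supported] E_group(1) bij_is_inj by metis

lemma E_outside: "g \<in> E \<Longrightarrow> x \<notin> I \<Longrightarrow> g x = x"
  using supported unfolding supp_subset_iff by blast

text \<open>Applying the power \<open>- q\<close> shows that \<open>y\<close> lies both in
  \<open>I\<close> and in its translate by the power \<open>p - q\<close>.\<close>

lemma zpow_eqD:
  assumes "zpow \<tau> p x = zpow \<tau> q y" "x \<in> I" "y \<in> I"
  shows "p = q" "x = y"
proof -
  have "zpow \<tau> (p - q) x = zpow \<tau> (- q) (zpow \<tau> p x)"
    using zpow_add[OF bij, of "- q" p x] by simp
  also have "\<dots> = y"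
    by (simp add: assms(1) bij)
  finally have *: "zpow \<tau> (p - q) x = y" .
  with assms disjoint[of "p - q"] show "p = q"
    by (cases "p = q") auto
  with * show "x = y"
    by simp
qed

lemma disjoint_translates: "p \<noteq> q \<Longrightarrow> zpow \<tau> p ` I \<inter> zpow \<tau> q ` I = {}"
  using zpow_eqD by blast

lemma I_subset_supp: "I \<subseteq> supp \<tau>"
  using disjoint[of 1] bij by (auto simp: mem_supp)

text \<open>Distinct blocks are disjoint, so a single point of \<open>I\<close> determines the
  shift. The coordinates then agree on \<open>I\<close>, and members of \<open>E\<close> are the
  identity off \<open>I\<close>.\<close>

lemma coords_unique:
  assumes "coords g k c" "coords g l d"
  shows "k = l" "c = d"
proof -
  have eq: "zpow \<tau> (p + k) (c p x) = zpow \<tau> (p + l) (d p x)" if "x \<in> I" for p x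
    using assms that unfolding coords_def by metis
  have cd: "c p \<in> E" "d p \<in> E" for p
    using assms unfolding coords_def by blast+
  note D = zpow_eqD[OF eq E_maps[OF cd(1)] E_maps[OF cd(2)]]
  obtain x where "x \<in> I"
    using nonempty by blast
  from D(1)[OF this this this, of 0] show "k = l"
    by simp
  show "c = d"
  proof (intro ext)
    fix p x
    show "c p x = d p x"
      by (cases "x \<in> I") (simp_all add: D(2) E_outside[OF cd(1)] E_outside[OF cd(2)])
  qed
qed

text \<open>The right factor acts first and carries block \<open>p\<close> to block
  \<open>p + l\<close>, where the coordinate of \<open>g\<close> must be read.\<close>

lemma coords_comp:
  assumes "coords g k c" "coords h l d"
  shows "coords (g \<circ> h) (k + l) (\<lambda>p. c (p + l) \<circ> d p)"
  unfolding coords_def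
proof (intro conjI allI ballI)
  have cd: "c p \<in> E" "d p \<in> E" for p
    using assms unfolding coords_def by blast+
  show "c (p + l) \<circ> d p \<in> E" for p
    using E_group(3) cd by blast
  have "{p. c (p + l) \<circ> d p \<noteq> id} \<subseteq> (\<lambda>p. p - l) ` {p. c p \<noteq> id} \<union> {p. d p \<noteq> id}"
    by (force simp: image_iff)
  moreover have "finite {p. c p \<noteq> id}" "finite {p. d p \<noteq> id}"
    using assms unfolding coords_def by blast+
  ultimately show "finite {p. c (p + l) \<circ> d p \<noteq> id}"
    by (meson finite_Un finite_imageI finite_subset)
  show "(g \<circ> h) (zpow \<tau> p x) = zpow \<tau> (p + (k + l)) ((c (p + l) \<circ> d p) x)" if "x \<in> I" for p x
    using assms that E_maps[OF cd(2) that] unfolding coords_def by (simp add: add_ac)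
qed

text \<open>Block \<open>p\<close> is the image under \<open>g\<close> of block
  \<open>p - k\<close>, so the coordinate there is the one to invert.\<close>

lemma coords_inv:
  assumes "coords g k c" "bij g"
  shows "coords (finv g) (- k) (\<lambda>p. finv (c (p - k)))"
  unfolding coords_def
proof (intro conjI allI ballI)
  have c: "c p \<in> E" for p
    using assms unfolding coords_def by blast
  show ic: "finv (c (p - k)) \<in> E" for p
    using E_group(4) c by blast
  have "{p. finv (c (p - k)) \<noteq> id} \<subseteq> (\<lambda>p. p + k) ` {p. c p \<noteq> id}"
  proof
    fix p assume "p \<in> {p. finv (c (p - k)) \<noteq> id}"
    then have "c (p - k) \<noteq> id"
      by auto
    then show "p \<in> (\<lambda>p. p + k) ` {p. c p \<noteq> id}"
      by (intro image_eqI[of _ _ "p - k"]) auto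
  qed
  moreover have "finite {p. c p \<noteq> id}"
    using assms unfolding coords_def by blast
  ultimately show "finite {p. finv (c (p - k)) \<noteq> id}"
    by (meson finite_imageI finite_subset)
  show "finv g (zpow \<tau> p x) = zpow \<tau> (p + - k) (finv (c (p - k)) x)" if "x \<in> I" for p x
  proof -
    have "g (zpow \<tau> (p - k) (finv (c (p - k)) x)) = zpow \<tau> p (c (p - k) (finv (c (p - k)) x))"
      using assms(1) E_maps[OF ic that] unfolding coords_def by simp
    also have "\<dots> = zpow \<tau> p x"
      using E_group(1)[OF c] by (simp add: bij_is_surj surj_f_inv_f)
    finally show ?thesis
      using assms(2) by (metis bij_inv_eq_iff uminus_add_conv_diff add.commute)
  qed
qed

lemma coords_base: "g \<in> E \<Longrightarrow> coords g 0 (\<lambda>p. if p = 0 then g else id)"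
  using disjoint E_group(2) by (auto simp: coords_def intro: E_outside)

lemma coords_shift: "coords \<tau> 1 (\<lambda>p. id)"
  by (simp add: coords_def E_group(2) zpow_Suc(2)[OF bij, symmetric] add.commute)

lemma subgroup_wreath: "subgroup wreath Sym"
proof (rule subgroup_SymI)
  show "id \<in> wreath"
    using coords_base[OF E_group(2)] by (auto simp: wreath_def mem_supp)
  show "f \<circ> g \<in> wreath" if fg: "f \<in> wreath" "g \<in> wreath" for f g
  proof -
    obtain k c l d where "coords f k c" "coords g l d"
      using fg unfolding wreath_def by blast
    then show ?thesis
      using fg coords_comp supp_comp[of f "supp \<tau>" g] bij_comp[of g f] unfolding wreath_def by blast
  qed
  show "finv f \<in> wreath" if "f \<in> wreath" for f
    using that coords_inv supp_inv[of f "supp \<tau>"] bij_imp_bij_inv unfolding wreath_def by blast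
qed (simp add: wreath_def)

lemma E_subset_wreath: "E \<subseteq> wreath"
  using coords_base E_group(1) supported I_subset_supp unfolding wreath_def by blast

lemma shift_in_wreath: "\<tau> \<in> wreath"
  using coords_shift bij unfolding wreath_def by blast

lemma wreath_on_block:
  assumes "g \<in> wreath"
  obtains k c where "c \<in> E" "\<And>x. x \<in> I \<Longrightarrow> g x = zpow \<tau> k (c x)"
proof -
  obtain k c where *: "coords g k c"
    using assms unfolding wreath_def by blast
  show thesis
  proof
    show "c 0 \<in> E"
      using * unfolding coords_def by blast
    show "g x = zpow \<tau> k (c 0 x)" if "x \<in> I" for x
    proof -
      have "g (zpow \<tau> 0 x) = zpow \<tau> (0 + k) (c 0 x)"
        using * that unfolding coords_def by blast
      then show ?thesis
        by simp
    qed
  qed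
qed

lemma wreath_image_block:
  assumes "g \<in> wreath"
  obtains k where "g ` I = zpow \<tau> k ` I"
proof -
  obtain k c where c: "c \<in> E" and g: "\<And>x. x \<in> I \<Longrightarrow> g x = zpow \<tau> k (c x)"
    using wreath_on_block[OF assms] by blast
  have "c ` I = I"
  proof (intro equalityI subsetI)
    fix x assume "x \<in> I"
    then have "finv c x \<in> I"
      using E_maps[OF E_group(4)[OF c]] by blast
    moreover have "c (finv c x) = x"
      using E_group(1)[OF c] by (simp add: bij_is_surj surj_f_inv_f)
    ultimately show "x \<in> c ` I"
      by (metis imageI)
  qed (use E_maps[OF c] in blast)
  with g have "g ` I = zpow \<tau> k ` I"
    by (metis (no_types, lifting) image_cong image_image)
  with that show thesis .
qed

text \<open>\<open>THE\<close> is justified by \<open>coords_unique\<close>. If \<phi> vanishes at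
  \<open>id\<close>, almost all terms are 0 and \<open>Sum_any\<close> is a finite sum.\<close>

definition total :: "(('x \<Rightarrow> 'x) \<Rightarrow> int) \<Rightarrow> ('x \<Rightarrow> 'x) \<Rightarrow> int" where
  "total \<phi> g = Sum_any (\<lambda>p. \<phi> ((THE c. \<exists>k. coords g k c) p))"

lemma total_eq:
  assumes "coords g k c"
  shows "total \<phi> g = Sum_any (\<lambda>p. \<phi> (c p))"
proof -
  have "(THE c. \<exists>k. coords g k c) = c"
    using assms coords_unique(2) by blast
  then show ?thesis
    by (simp add: total_def)
qed

text \<open>The shift \<open>l\<close> only reindexes the coordinates of \<open>g\<close>, and a sum
  over all integers does not see this. Finite support allows the sum to be split.\<close>

lemma total_comp:
  assumes \<phi>: "\<And>f g. f \<in> E \<Longrightarrow> g \<in> E \<Longrightarrow> \<phi> (f \<circ> g) = \<phi> f + \<phi> g"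
    and "g \<in> wreath" "h \<in> wreath"
  shows "total \<phi> (g \<circ> h) = total \<phi> g + total \<phi> h"
proof -
  obtain k c l d where gc: "coords g k c" and hd: "coords h l d"
    using assms unfolding wreath_def by blast
  have id: "\<phi> id = 0"
    using \<phi>[OF E_group(2) E_group(2)] by simp
  have cd: "c p \<in> E" "d p \<in> E" for p
    using gc hd unfolding coords_def by blast+
  have "{p. \<phi> (c p) \<noteq> 0} \<subseteq> {p. c p \<noteq> id}" "{p. \<phi> (d p) \<noteq> 0} \<subseteq> {p. d p \<noteq> id}"
    using id by auto
  then have fin: "finite {p. \<phi> (c p) \<noteq> 0}" "finite {p. \<phi> (d p) \<noteq> 0}"
    using gc hd finite_subset unfolding coords_def by metis+
  have "{p. \<phi> (c (p + l)) \<noteq> 0} = (\<lambda>p. p - l) ` {p. \<phi> (c p) \<noteq> 0}"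
    by (force simp: image_iff)
  with fin(1) have fin': "finite {p. \<phi> (c (p + l)) \<noteq> 0}"
    by simp
  have "total \<phi> (g \<circ> h) = Sum_any (\<lambda>p. \<phi> (c (p + l)) + \<phi> (d p))"
    by (simp add: total_eq[OF coords_comp[OF gc hd]] \<phi> cd)
  also have "\<dots> = Sum_any (\<lambda>p. \<phi> (c (p + l))) + Sum_any (\<lambda>p. \<phi> (d p))"
    by (rule Sum_any.distrib[OF fin' fin(2)])
  also have "Sum_any (\<lambda>p. \<phi> (c (p + l))) = Sum_any (\<lambda>p. \<phi> (c p))"
    by (rule Sum_any.reindex_cong[of "\<lambda>p. p + l", symmetric])
       (auto simp: fun_eq_iff intro: bij_plus_right)
  finally show ?thesis
    by (simp only: total_eq[OF gc] total_eq[OF hd])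
qed

lemma total_base:
  assumes "\<phi> id = 0" "g \<in> E"
  shows "total \<phi> g = \<phi> g"
proof -
  have "total \<phi> g = Sum_any (\<lambda>p. \<phi> (if p = (0::int) then g else id))"
    by (rule total_eq[OF coords_base[OF assms(2)]])
  also have "\<dots> = Sum_any (\<lambda>p. if p = (0::int) then \<phi> g else 0)"
    by (rule Sum_any.cong) (simp add: assms(1))
  also have "\<dots> = \<phi> g"
    using Sum_any.delta'[of 0 "\<lambda>_. \<phi> g"] Sum_any.delta[of 0 "\<lambda>_. \<phi> g"] by simp
  finally show ?thesis .
qed

end


section \<open>Commutators in binate and dissipated groups\<close>

lemma commutator_subgroup_trivial_iff:
  assumes "group G" "H \<subseteq> carrier G" "K \<subseteq> carrier G"
  shows "commutator_subgroup G H K = {\<one>\<^bsub>G\<^esub>} \<longleftrightarrow> (\<forall>h\<in>H. \<forall>k\<in>K. h \<otimes>\<^bsub>G\<^esub> k = k \<otimes>\<^bsub>G\<^esub> h)"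
proof -
  interpret group G by fact
  have comm: "h \<otimes>\<^bsub>G\<^esub> k \<otimes>\<^bsub>G\<^esub> inv\<^bsub>G\<^esub> h \<otimes>\<^bsub>G\<^esub> inv\<^bsub>G\<^esub> k = \<one>\<^bsub>G\<^esub> \<longleftrightarrow> h \<otimes>\<^bsub>G\<^esub> k = k \<otimes>\<^bsub>G\<^esub> h"
    if "h \<in> carrier G" "k \<in> carrier G" for h k
    using that by (metis inv_closed inv_inv inv_solve_right m_closed l_one one_closed)
  let ?S = "\<Union>h\<in>H. \<Union>k\<in>K. {h \<otimes>\<^bsub>G\<^esub> k \<otimes>\<^bsub>G\<^esub> inv\<^bsub>G\<^esub> h \<otimes>\<^bsub>G\<^esub> inv\<^bsub>G\<^esub> k}"
  have "generate G ?S = {\<one>\<^bsub>G\<^esub>} \<longleftrightarrow> ?S \<subseteq> {\<one>\<^bsub>G\<^esub>}"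
    using generate.incl[of _ ?S G] generate.one[of G ?S] generate_subgroup_incl[OF _ triv_subgroup, of ?S]
    by blast
  also have "\<dots> \<longleftrightarrow> (\<forall>h\<in>H. \<forall>k\<in>K. h \<otimes>\<^bsub>G\<^esub> k = k \<otimes>\<^bsub>G\<^esub> h)"
    using comm assms(2,3) by blast
  finally show ?thesis
    by (simp add: commutator_subgroup_def)
qed

section \<open>Conjugation in a group\<close>

context group
begin

lemma conj_by_closed: "g \<in> carrier G \<Longrightarrow> a \<in> carrier G \<Longrightarrow> conj_by G g a \<in> carrier G"
  by (simp add: conj_by_def)

lemma conj_by_mult:
  assumes "g \<in> carrier G" "a \<in> carrier G" "b \<in> carrier G"
  shows "conj_by G g (a \<otimes> b) = conj_by G g a \<otimes> conj_by G g b"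
proof -
  have "inv g \<otimes> (g \<otimes> (b \<otimes> inv g)) = b \<otimes> inv g"
    using assms by (metis inv_closed l_inv l_one m_assoc m_closed)
  with assms show ?thesis
    by (simp add: conj_by_def m_assoc)
qed

lemma conj_by_comp:
  "g \<in> carrier G \<Longrightarrow> h \<in> carrier G \<Longrightarrow> a \<in> carrier G \<Longrightarrow>
    conj_by G (g \<otimes> h) a = conj_by G g (conj_by G h a)"
  by (simp add: conj_by_def inv_mult_group m_assoc)

lemma conj_by_eq_iff:
  assumes "g \<in> carrier G" "a \<in> carrier G" "b \<in> carrier G"
  shows "conj_by G g a = b \<longleftrightarrow> g \<otimes> a = b \<otimes> g"
  using assms by (metis conj_by_def inv_closed inv_solve_right inv_inv m_closed)

text \<open>Conjugation by \<open>g\<close> is an automorphism. This transports commutation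
  relations in \<Lambda> to a conjugate of \<Lambda>, with \<open>u\<close> replaced by its
  conjugate.\<close>

lemma commute_conj_by:
  assumes "g \<in> carrier G" "u \<in> carrier G" "a \<in> carrier G" "b \<in> carrier G"
    and comm: "a \<otimes> conj_by G u b = conj_by G u b \<otimes> a"
  shows "conj_by G g a \<otimes> conj_by G (conj_by G g u) (conj_by G g b) =
    conj_by G (conj_by G g u) (conj_by G g b) \<otimes> conj_by G g a"
proof -
  have "conj_by G g u \<otimes> g = g \<otimes> u"
    using assms by (metis conj_by_closed conj_by_eq_iff)
  then have eq: "conj_by G (conj_by G g u) (conj_by G g b) = conj_by G g (conj_by G u b)"
    using assms by (metis conj_by_closed conj_by_comp)
  show ?thesis
    using assms unfolding eq by (metis conj_by_closed conj_by_mult)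
qed

end

text \<open>The property is applied to the cyclic group generated by \<open>h\<close>. The equation
  obtained makes \<open>h\<close> the commutator of \<open>t\<close> and \<open>f\<close>.\<close>

lemma binate_commutator:
  assumes "group G" "binate G" "h \<in> carrier G"
  obtains f t where "f \<in> carrier G" "t \<in> carrier G" "conj_by G t f = h \<otimes>\<^bsub>G\<^esub> f"
proof -
  have "fin_gen_subgroup (generate G {h}) G"
    unfolding fin_gen_subgroup_def using assms(3) by (intro exI[of _ "{h}"]) simp
  then obtain f t where f: "f \<in> hom (G\<lparr>carrier := generate G {h}\<rparr>) G" and t: "t \<in> carrier G"
    and conj: "\<forall>x\<in>generate G {h}. conj_by G t (f x) = x \<otimes>\<^bsub>G\<^esub> f x"
    using assms(2) unfolding binate_def by blast
  have h: "h \<in> generate G {h}"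
    by (simp add: generate.incl)
  with f have "f h \<in> carrier G"
    by (auto simp: hom_def)
  with that t conj h show thesis
    by blast
qed

lemma mult_BijGroup:
  "f \<in> Bij X \<Longrightarrow> g \<in> Bij X \<Longrightarrow> x \<in> X \<Longrightarrow> (f \<otimes>\<^bsub>BijGroup X\<^esub> g) x = f (g x)"
  by (simp add: BijGroup_def compose_def)

text \<open>The map \<open>f\<close> attached to \<open>h\<close> by the dissipator \<open>t\<close> is the product of the conjugates of \<open>h\<close>
  by \<open>t\<^sup>p\<close>, \<open>p \<ge> 1\<close>, so conjugating it by \<open>t\<^sup>-\<^sup>1\<close> adds the factor \<open>h\<close>.\<close>

lemma dissipator_commutator:
  assumes D: "subgroup D (BijGroup X)" and "dissipator X D Y t" "Y \<subseteq> X"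
    and h: "h \<in> D" "supp_on X h \<subseteq> Y"
  obtains f where "f \<in> D" "conj_by (BijGroup X) (inv\<^bsub>BijGroup X\<^esub> t) f = h \<otimes>\<^bsub>BijGroup X\<^esub> f"
proof -
  interpret B: group "BijGroup X"
    by (rule group_BijGroup)
  have carrier: "carrier (BijGroup X) = Bij X"
    by (simp add: BijGroup_def)
  have D_Bij: "g \<in> D \<Longrightarrow> g \<in> Bij X" for g
    using subgroup.mem_carrier[OF D] carrier by blast
  define z where "z p = t [^]\<^bsub>BijGroup X\<^esub> p" for p :: int
  obtain f where f: "f \<in> D"
    and f_translate: "\<And>p x. p \<ge> 1 \<Longrightarrow> x \<in> z p ` Y \<Longrightarrow> f x = conj_by (BijGroup X) (z p) h x"
    and f_outside: "\<And>x. x \<in> X - (\<Union>p\<in>{1::int..}. z p ` Y) \<Longrightarrow> f x = x"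
    using assms unfolding dissipator_def z_def by metis
  have t: "t \<in> D" and disj: "\<And>p. p \<ge> 1 \<Longrightarrow> z p ` Y \<inter> Y = {}"
    using assms unfolding dissipator_def z_def by blast+
  have z_Bij: "z p \<in> Bij X" for p
    using B.int_pow_closed[of t p] D_Bij[OF t] by (simp add: z_def carrier)
  have z_add: "z (p + q) x = z p (z q x)" if "x \<in> X" for p q x
    using B.int_pow_mult[of t p q] D_Bij[OF t] mult_BijGroup[OF z_Bij z_Bij that, of p q]
    by (simp add: z_def carrier)
  have z_0: "z 0 x = x" if "x \<in> X" for x
    using that by (simp add: z_def BijGroup_def)
  have z_1: "z 1 = t"
    using D_Bij[OF t] by (simp add: z_def carrier)
  have in_X: "g x \<in> X" if "g \<in> Bij X" "x \<in> X" for g x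
    using that by (auto simp: Bij_def bij_betw_def)
  have inj: "inj_on g X" if "g \<in> Bij X" for g
    using that by (auto simp: Bij_def bij_betw_def)
  have conj_z: "conj_by (BijGroup X) (z p) h (z p y) = z p (h y)" if "y \<in> X" for p y
  proof -
    have "conj_by (BijGroup X) (z p) h \<otimes>\<^bsub>BijGroup X\<^esub> z p = z p \<otimes>\<^bsub>BijGroup X\<^esub> h"
      using B.conj_by_eq_iff[of "z p" h] B.conj_by_closed[of "z p" h] z_Bij D_Bij h(1) carrier by metis
    moreover have "conj_by (BijGroup X) (z p) h \<in> Bij X"
      using B.conj_by_closed z_Bij D_Bij h(1) carrier by metis
    ultimately show ?thesis
      using that mult_BijGroup z_Bij D_Bij h(1) by metis
  qed
  have h_outside: "h x = x" if "x \<in> X" "x \<notin> Y" for x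
    using h(2) that by (auto simp: supp_on_def)
  have h_Y: "h y \<in> Y" if "y \<in> Y" for y
  proof (rule ccontr)
    assume *: "h y \<notin> Y"
    have "y \<in> X"
      using that assms(3) by blast
    then have "h (h y) = h y" "h y \<in> X"
      using * in_X D_Bij h(1) h_outside by blast+
    with \<open>y \<in> X\<close> have "h y = y"
      using inj[OF D_Bij[OF h(1)]] by (metis inj_onD)
    with * that show False
      by simp
  qed
  have f_z: "f (z p y) = z p (h y)" if "p \<ge> 1" "y \<in> Y" for p y
    using f_translate[of p "z p y"] conj_z that assms(3) by auto
  \<comment> \<open>For \<open>x\<close> in \<open>Y\<close> or in a positive translate of
    \<open>Y\<close>, both sides apply \<open>h\<close> once, inside the next translate. For all
    other \<open>x\<close>, both sides are \<open>t x\<close>.\<close>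
  have pointwise: "f (t x) = t (h (f x))" if x: "x \<in> X" for x
  proof -
    have tx: "t x \<in> X"
      using in_X D_Bij t x by blast
    consider "x \<in> Y" | p y where "p \<ge> 1" "y \<in> Y" "x = z p y" | "x \<notin> Y" "x \<notin> (\<Union>p\<in>{1::int..}. z p ` Y)"
      by auto
    then show ?thesis
    proof cases
      case 1
      then have "x \<notin> (\<Union>p\<in>{1::int..}. z p ` Y)"
        using disj by auto
      with x have "f x = x"
        using f_outside by blast
      with 1 show ?thesis
        using f_z[of 1 x] z_1 by simp
    next
      case 2
      have "y \<in> X" "h y \<in> Y" "h y \<in> X"
        using 2 h_Y assms(3) by blast+
      then have "z p (h y) \<notin> Y" "z p (h y) \<in> X"
        using 2 disj[of p] in_X[OF z_Bij] by blast+
      then have "h (f x) = z p (h y)"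
        using 2 f_z h_outside by simp
      moreover have "f (z (1 + p) y) = z (1 + p) (h y)"
        using 2 by (intro f_z) auto
      ultimately show ?thesis
        using 2 z_add[of _ 1 p] z_1 \<open>y \<in> X\<close> \<open>h y \<in> X\<close> by simp
    next
      case 3
      \<comment> \<open>Were \<open>t x\<close> in the translate with index \<open>p\<close>, then
        \<open>x\<close> would lie in the one with index \<open>p - 1\<close>, which is
        \<open>Y\<close> itself when \<open>p = 1\<close>.\<close>
      have "t x \<notin> (\<Union>p\<in>{1::int..}. z p ` Y)"
      proof
        assume "t x \<in> (\<Union>p\<in>{1::int..}. z p ` Y)"
        then obtain p y where p: "p \<ge> 1" "y \<in> Y" "t x = z p y"
          by auto
        have y: "y \<in> X"
          using p assms(3) by blast
        have "z p y = t (z (p - 1) y)"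
          using z_add[OF y, of 1 "p - 1"] z_1 by simp
        then have "x = z (p - 1) y"
          using p inj[OF D_Bij[OF t]] in_X[OF z_Bij y] x by (metis inj_onD)
        with p y 3 z_0 show False
          by (cases "p = 1") auto
      qed
      with 3 x tx show ?thesis
        using f_outside h_outside by simp
    qed
  qed
  have "f \<otimes>\<^bsub>BijGroup X\<^esub> t = t \<otimes>\<^bsub>BijGroup X\<^esub> (h \<otimes>\<^bsub>BijGroup X\<^esub> f)"
  proof -
    have "f \<otimes>\<^bsub>BijGroup X\<^esub> t \<in> Bij X" "t \<otimes>\<^bsub>BijGroup X\<^esub> (h \<otimes>\<^bsub>BijGroup X\<^esub> f) \<in> Bij X"
      "h \<otimes>\<^bsub>BijGroup X\<^esub> f \<in> Bij X"
      using f t h(1) D D_Bij by (auto intro: subgroup.m_closed)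
    \<comment> \<open>Elements of \<open>Bij X\<close> are extensional, so agreement on
      \<open>X\<close> is equality.\<close>
    then show ?thesis
      using pointwise D_Bij f t h(1)
      by (intro extensionalityI[of _ X]) (auto simp: mult_BijGroup Bij_def)
  qed
  then have "conj_by (BijGroup X) (inv\<^bsub>BijGroup X\<^esub> t) f = h \<otimes>\<^bsub>BijGroup X\<^esub> f"
    using D_Bij[OF f] D_Bij[OF t] D_Bij[OF h(1)] carrier
    by (metis conj_by_def B.inv_closed B.inv_inv B.inv_solve_left B.m_assoc B.m_closed)
  with f that show thesis
    by blast
qed

text \<open>By bounded support, some dissipator applies to the image of \<open>h\<close>; the
  resulting commutator equation is pulled back along the isomorphism.\<close>

lemma dissipated_commutator:
  fixes G :: "('a, 'b) monoid_scheme"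
  assumes G: "group G" and "dissipated TYPE('x) TYPE('i) G" and h: "h \<in> carrier G"
  obtains f t where "f \<in> carrier G" "t \<in> carrier G" "conj_by G t f = h \<otimes>\<^bsub>G\<^esub> f"
proof -
  obtain X :: "'x set" and I :: "'i set" and le Xs D
    where act: "dissipated_action X I le Xs D" and iso: "G \<cong> (BijGroup X)\<lparr>carrier := D\<rparr>"
    using assms(2) unfolding dissipated_def by blast
  let ?M = "(BijGroup X)\<lparr>carrier := D\<rparr>"
  interpret B: group "BijGroup X"
    by (rule group_BijGroup)
  have D: "subgroup D (BijGroup X)"
    using act by (simp add: dissipated_action_def)
  obtain \<phi> where "\<phi> \<in> iso G ?M"
    using iso unfolding is_iso_def by blast
  then have hom: "\<phi> \<in> hom G ?M" and bij: "bij_betw \<phi> (carrier G) D"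
    by (auto simp: iso_def)
  interpret group_hom G ?M \<phi>
    using G B.subgroup_imp_group[OF D] hom by (simp add: group_hom_def group_hom_axioms_def)
  have \<phi>: "\<phi> x \<in> D" if "x \<in> carrier G" for x
    using hom_closed[OF that] by simp
  obtain i where "i \<in> I" "supp_on X (\<phi> h) \<subseteq> Xs i"
    using act \<phi>[OF h] unfolding dissipated_action_def by blast
  moreover from this obtain t where t: "dissipator X D (Xs i) t"
    using act unfolding dissipated_action_def by blast
  moreover have "Xs i \<subseteq> X"
    using act \<open>i \<in> I\<close> unfolding dissipated_action_def directed_union_def by blast
  ultimately obtain f where f: "f \<in> D"
    and eq: "conj_by (BijGroup X) (inv\<^bsub>BijGroup X\<^esub> t) f = \<phi> h \<otimes>\<^bsub>BijGroup X\<^esub> f"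
    using dissipator_commutator[OF D t _ \<phi>[OF h]] by blast
  have "inv\<^bsub>BijGroup X\<^esub> t \<in> D"
    using t subgroup.m_inv_closed[OF D] by (simp add: dissipator_def)
  then obtain f' t' where f': "f' \<in> carrier G" "f = \<phi> f'" and t': "t' \<in> carrier G" "inv\<^bsub>BijGroup X\<^esub> t = \<phi> t'"
    using bij f unfolding bij_betw_def by (metis imageE)
  have "conj_by ?M (\<phi> t') (\<phi> f') = \<phi> h \<otimes>\<^bsub>?M\<^esub> \<phi> f'"
    using eq unfolding f' t' by (simp add: conj_by_def B.m_inv_consistent[OF D \<phi>[OF t'(1)]])
  then have "\<phi> (conj_by G t' f') = \<phi> (h \<otimes>\<^bsub>G\<^esub> f')"
    using f' t' h unfolding conj_by_def by simp
  then have "conj_by G t' f' = h \<otimes>\<^bsub>G\<^esub> f'"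
    using bij f' t' h unfolding bij_betw_def by (meson G.conj_by_closed G.m_closed inj_onD)
  with f' t' that show thesis
    by blast
qed


section \<open>Thompson's group and homeomorphisms of the line\<close>

definition germ :: "(real \<Rightarrow> real) \<Rightarrow> int \<Rightarrow> bool" where
  "germ g k \<longleftrightarrow> (\<exists>\<epsilon>>0. \<forall>x. 0 < x \<and> x < \<epsilon> \<longrightarrow> g x = 2 powi k * x)"

definition germs :: "(real \<Rightarrow> real) set" where
  "germs = {g. bij g \<and> supp g \<subseteq> {0<..<1} \<and> (\<exists>k. germ g k)}"

definition slope_exponent :: "(real \<Rightarrow> real) \<Rightarrow> int" where
  "slope_exponent g = (THE k. germ g k)"

lemma germ_unique:
  assumes "germ g k" "germ g l"
  shows "k = l"
proof -
  obtain \<epsilon> \<delta> where "\<epsilon> > 0" "\<forall>x. 0 < x \<and> x < \<epsilon> \<longrightarrow> g x = 2 powi k * x"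
    and "\<delta> > 0" "\<forall>x. 0 < x \<and> x < \<delta> \<longrightarrow> g x = 2 powi l * x"
    using assms unfolding germ_def by blast
  moreover from this have "0 < min \<epsilon> \<delta> / 2" "min \<epsilon> \<delta> / 2 < \<epsilon>" "min \<epsilon> \<delta> / 2 < \<delta>"
    by auto
  ultimately have "2 powi k * (min \<epsilon> \<delta> / 2) = 2 powi l * (min \<epsilon> \<delta> / 2)"
    by metis
  with \<open>0 < min \<epsilon> \<delta> / 2\<close> have "(2::real) powi k = 2 powi l"
    by (metis less_irrefl mult_right_cancel)
  then show ?thesis
    using power_int_strict_increasing[of k l "2::real"] power_int_strict_increasing[of l k "2::real"]
    by (cases k l rule: linorder_cases) auto
qed

lemma slope_exponent_eq: "germ g k \<Longrightarrow> slope_exponent g = k"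
  unfolding slope_exponent_def using germ_unique by blast

lemma germ_comp:
  assumes "germ g k" "germ h l"
  shows "germ (g \<circ> h) (k + l)"
proof -
  obtain \<epsilon> \<delta> where \<epsilon>: "\<epsilon> > 0" "\<forall>x. 0 < x \<and> x < \<epsilon> \<longrightarrow> g x = 2 powi k * x"
    and \<delta>: "\<delta> > 0" "\<forall>x. 0 < x \<and> x < \<delta> \<longrightarrow> h x = 2 powi l * x"
    using assms unfolding germ_def by blast
  have "(g \<circ> h) x = 2 powi (k + l) * x" if "0 < x" "x < min \<delta> (\<epsilon> / 2 powi l)" for x
  proof -
    have "0 < 2 powi l * x" "2 powi l * x < \<epsilon>"
      using that by (auto simp: pos_less_divide_eq mult.commute)
    then show ?thesis
      using that \<epsilon> \<delta> by (simp add: power_int_add)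
  qed
  moreover have "min \<delta> (\<epsilon> / 2 powi l) > 0"
    using \<epsilon> \<delta> by simp
  ultimately show ?thesis
    unfolding germ_def by blast
qed

lemma germ_inv:
  assumes "germ g k" "bij g"
  shows "germ (finv g) (- k)"
proof -
  obtain \<epsilon> where \<epsilon>: "\<epsilon> > 0" "\<forall>x. 0 < x \<and> x < \<epsilon> \<longrightarrow> g x = 2 powi k * x"
    using assms unfolding germ_def by blast
  have "finv g x = 2 powi (- k) * x" if "0 < x" "x < \<epsilon> * 2 powi k" for x
  proof -
    have "g (2 powi (- k) * x) = x"
      using \<epsilon>(2)[rule_format, of "2 powi (- k) * x"] that
      by (simp add: power_int_minus field_simps)
    then show ?thesis
      using assms(2) by (metis bij_inv_eq_iff)
  qed
  moreover have "\<epsilon> * 2 powi k > 0"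
    using \<epsilon> by simp
  ultimately show ?thesis
    unfolding germ_def by blast
qed

lemma subgroup_germs: "subgroup germs Sym"
proof (rule subgroup_SymI)
  have "germ id 0"
    unfolding germ_def by (intro exI[of _ 1]) simp
  then show "id \<in> germs"
    by (auto simp: germs_def mem_supp)
  show "f \<circ> g \<in> germs" if "f \<in> germs" "g \<in> germs" for f g
    using that germ_comp supp_comp[of f _ g] bij_comp[of g f] unfolding germs_def by blast
  show "finv f \<in> germs" if "f \<in> germs" for f
    using that germ_inv supp_inv[of f] bij_imp_bij_inv unfolding germs_def by blast
qed (simp add: germs_def)

lemma slope_exponent_comp:
  "g \<in> germs \<Longrightarrow> h \<in> germs \<Longrightarrow> slope_exponent (g \<circ> h) = slope_exponent g + slope_exponent h"
  unfolding germs_def using germ_comp slope_exponent_eq by fastforce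

lemma homeomorphism_UNIV_bij: "homeomorphism UNIV UNIV g g' \<Longrightarrow> bij g"
  by (rule o_bij[of g']) (auto simp: homeomorphism_def)

text \<open>Finitely many breakpoints leave an interval to the right of 0 on which \<open>g\<close>
  is affine; continuity and \<open>g 0 = 0\<close> remove the constant term.\<close>

lemma Thompson_F_subset_germs: "Thompson_F \<subseteq> germs"
proof
  fix g assume "g \<in> Thompson_F"
  then obtain g' B where g: "homeomorphism UNIV UNIV g g'" "supp g \<subseteq> {0<..<1}" and B: "finite B"
    and affine: "\<And>a b. {a<..<b} \<subseteq> {0<..<1} - B \<Longrightarrow> \<exists>(k::int) c. \<forall>x\<in>{a<..<b}. g x = 2 powi k * x + c"
    unfolding Thompson_F_def by blast
  \<comment> \<open>Inserting 1 keeps the set nonempty and the interval inside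
    \<open>{0<..<1}\<close>.\<close>
  define \<epsilon> where "\<epsilon> = Min (insert 1 (B \<inter> {0<..}))"
  have \<epsilon>: "\<epsilon> > 0"
    using B by (simp add: \<epsilon>_def)
  have le: "\<epsilon> \<le> x" if "x = 1 \<or> x \<in> B \<and> x > 0" for x
    unfolding \<epsilon>_def using B that by (intro Min_le) auto
  have "{0<..<\<epsilon>} \<subseteq> {0<..<1} - B"
  proof
    fix x assume "x \<in> {0<..<\<epsilon>}"
    then show "x \<in> {0<..<1} - B"
      using le[of x] le[of 1] by auto
  qed
  then obtain k c where kc: "\<forall>x\<in>{0<..<\<epsilon>}. g x = 2 powi k * x + c"
    using affine by blast
  have "isCont g 0"
    using homeomorphism_cont1[OF g(1)] by (simp add: continuous_on_eq_continuous_at)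
  then have "(g \<longlongrightarrow> g 0) (at_right 0)"
    by (simp add: isCont_def filterlim_at_split)
  moreover have "((\<lambda>x. 2 powi k * x + c) \<longlongrightarrow> 2 powi k * 0 + c) (at_right 0)"
    by (intro tendsto_intros)
  moreover have "\<forall>\<^sub>F x in at_right 0. g x = 2 powi k * x + c"
    using \<epsilon> kc unfolding eventually_at_right_field by (metis greaterThanLessThan_iff)
  ultimately have "g 0 = 2 powi k * 0 + c"
    using tendsto_cong[of g "\<lambda>x. 2 powi k * x + c" "at_right 0"]
      tendsto_unique[OF trivial_limit_at_right_real] by blast
  moreover have "g 0 = 0"
    using g(2) by (auto simp: supp_subset_iff)
  ultimately have "germ g k"
    unfolding germ_def using kc \<epsilon> by (intro exI[of _ \<epsilon>]) simp
  then show "g \<in> germs"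
    using g homeomorphism_UNIV_bij unfolding germs_def by blast
qed

text \<open>On \<open>[0, 1]\<close> this is the convex element of Thompson's group with slopes \<open>1/2\<close>, \<open>1\<close>, \<open>2\<close>;
  the outer minimum makes it the identity elsewhere.\<close>

definition seed :: "real \<Rightarrow> real" where
  "seed x = min x (max (x / 2) (max (x - 1 / 4) (2 * x - 1)))"

lemma seed_eq:
  "seed x = (if x \<le> 0 \<or> 1 \<le> x then x else if x \<le> 1 / 2 then x / 2
     else if x \<le> 3 / 4 then x - 1 / 4 else 2 * x - 1)"
  by (auto simp: seed_def min_def max_def)

lemma seed_in_Thompson_F: "seed \<in> Thompson_F"
proof -
  \<comment> \<open>Each branch of \<open>seed\<close> is replaced by its inverse, and
    \<open>min\<close> and \<open>max\<close> are exchanged; this inverts such a combination of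
    increasing bijections.\<close>
  let ?inv = "\<lambda>x::real. max x (min (2 * x) (min (x + 1 / 4) ((x + 1) / 2)))"
  have inv_eq: "?inv x = (if x \<le> 0 \<or> 1 \<le> x then x else if x \<le> 1 / 4 then 2 * x
     else if x \<le> 1 / 2 then x + 1 / 4 else (x + 1) / 2)" for x
    by (auto simp: min_def max_def)
  have "homeomorphism UNIV UNIV seed ?inv"
  proof (rule homeomorphismI)
    show "continuous_on UNIV seed" "continuous_on UNIV ?inv"
      unfolding seed_def by (intro continuous_intros; simp)+
    show "?inv (seed x) = x" "seed (?inv x) = x" for x
      unfolding seed_eq inv_eq by (auto simp: field_simps)
  qed auto
  then have homeo: "\<exists>g'. homeomorphism UNIV UNIV seed g'"
    by (rule exI[of _ ?inv])
  have supp: "supp seed \<subseteq> {0<..<1}"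
    unfolding supp_subset_iff by (auto simp: seed_eq)
  have dyadic: "{1 / 2, 3 / 4} \<subseteq> dyadic_rationals"
  proof -
    have "(1 / 2 :: real) = real_of_int 1 / 2 ^ 1" "(3 / 4 :: real) = real_of_int 3 / 2 ^ 2"
      by simp_all
    then show ?thesis
      unfolding dyadic_rationals_def by blast
  qed
  have affine: "\<exists>(k::int) c. \<forall>x\<in>{a<..<b}. seed x = 2 powi k * x + c"
    if ab: "{a<..<b} \<subseteq> {0<..<1} - {1 / 2, 3 / 4}" for a b
  proof (cases "a < b")
    case True
    have "{a<..<b} \<subseteq> {0<..<1}"
      using ab by blast
    with True have "0 \<le> a" "b \<le> 1"
      by (simp_all add: greaterThanLessThan_subseteq_greaterThanLessThan)
    moreover have "1 / 2 \<notin> {a<..<b}" "3 / 4 \<notin> {a<..<b}"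
      using ab by blast+
    then have "b \<le> 1 / 2 \<or> 1 / 2 \<le> a" "b \<le> 3 / 4 \<or> 3 / 4 \<le> a"
      by auto
    ultimately consider "0 \<le> a" "b \<le> 1 / 2" | "1 / 2 \<le> a" "b \<le> 3 / 4" | "3 / 4 \<le> a" "b \<le> 1"
      using True by linarith
    then show ?thesis
    proof cases
      case 1
      then show ?thesis
        by (intro exI[of _ "-1"] exI[of _ 0]) (auto simp: seed_eq)
    next
      case 2
      then show ?thesis
        by (intro exI[of _ 0] exI[of _ "- 1 / 4"]) (auto simp: seed_eq)
    next
      case 3
      then show ?thesis
        by (intro exI[of _ 1] exI[of _ "- 1"]) (auto simp: seed_eq)
    qed
  qed auto
  have "finite {1 / 2, 3 / 4 :: real}"
    by simp
  with homeo supp dyadic affine show ?thesis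
    unfolding Thompson_F_def mem_Collect_eq by (intro conjI exI[of _ "{1 / 2, 3 / 4}"]) simp_all
qed

lemma slope_exponent_seed: "slope_exponent seed = - 1"
proof (rule slope_exponent_eq)
  have "seed x = 2 powi (- 1) * x" if "0 < x" "x < 1 / 2" for x
    using that by (simp add: seed_eq)
  then show "germ seed (- 1)"
    unfolding germ_def by (intro exI[of _ "1 / 2"]) simp
qed

text \<open>A continuous injection is monotone on an interval. Compact support gives fixed points
  far out on both sides, which exclude the decreasing case.\<close>

lemma Homeo_c_strict_mono:
  assumes "g \<in> Homeo_c"
  shows "strict_mono g"
proof -
  obtain g' where g: "homeomorphism UNIV UNIV g g'" and compact: "compact (closure (supp g))"
    using assms unfolding Homeo_c_def by blast
  have "bounded (supp g)"
    using compact compact_imp_bounded bounded_subset closure_subset by metis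
  then obtain M where M: "\<And>x. x \<in> supp g \<Longrightarrow> \<bar>x\<bar> \<le> M"
    unfolding bounded_real by blast
  have fixed: "g x = x" if "\<bar>x\<bar> > M" for x
    using M[of x] that by (force simp: mem_supp)
  show ?thesis
  proof (rule strict_monoI)
    fix x y :: real assume "x < y"
    define a b where "a = - (\<bar>M\<bar> + \<bar>x\<bar> + \<bar>y\<bar> + 1)" and "b = \<bar>M\<bar> + \<bar>x\<bar> + \<bar>y\<bar> + 1"
    have ab: "a < x" "x < y" "y < b" "g a = a" "g b = b"
      using \<open>x < y\<close> by (auto simp: a_def b_def intro!: fixed)
    have cont: "continuous_on S g" for S
      using homeomorphism_cont1[OF g] continuous_on_subset by blast
    have inj: "inj_on g S" for S
      using homeomorphism_UNIV_bij[OF g] bij_is_inj inj_on_subset by blast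
    have *: "g a < g x \<and> g x < g b"
      using continuous_inj_imp_mono[of a x b g, OF _ _ cont inj] ab by auto
    have "g x < g y \<and> g y < g b \<or> g b < g y \<and> g y < g x"
      using continuous_inj_imp_mono[of x y b g, OF _ _ cont inj] ab by auto
    with * show "g x < g y"
      by linarith
  qed
qed

text \<open>Connectedness puts the image of \<open>I\<close> wholly on one side of \<open>I\<close>,
  and monotonicity keeps all further images on that side.\<close>

lemma translates_disjoint:
  fixes \<tau> :: "real \<Rightarrow> real"
  assumes "bij \<tau>" "strict_mono \<tau>" "continuous_on UNIV \<tau>" "connected I" "\<tau> ` I \<inter> I = {}" "p \<noteq> 0"
  shows "zpow \<tau> p ` I \<inter> I = {}"
proof -
  have conn: "connected (\<tau> ` I)"
    using assms connected_continuous_image continuous_on_subset by blast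
  have pos: "zpow \<tau> (1 + int n) ` I \<inter> I = {}" for n
  proof (cases "\<exists>x\<in>I. \<exists>y\<in>I. y < \<tau> x")
    case True
    \<comment> \<open>If both orders occurred, either \<open>\<tau> x\<close> would lie between two
      points of \<open>I\<close>, or \<open>y'\<close> between two points of the image of
      \<open>I\<close>. Both contradict disjointness.\<close>
    have up: "y < \<tau> x" if "x \<in> I" "y \<in> I" for x y
    proof (rule ccontr)
      assume "\<not> y < \<tau> x"
      with that assms(5) have "\<tau> x < y"
        by (metis disjoint_iff imageI linorder_neqE)
      obtain x' y' where *: "x' \<in> I" "y' \<in> I" "y' < \<tau> x'"
        using True by blast
      show False
      proof (cases "y' < \<tau> x")
        case True
        then have "\<tau> x \<in> I"
          using assms(4) * that \<open>\<tau> x < y\<close> unfolding connected_iff_interval by (meson less_imp_le)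
        with that assms(5) show False
          by blast
      next
        case False
        then have "y' \<in> \<tau> ` I"
          using conn * that unfolding connected_iff_interval by (meson imageI less_imp_le not_less)
        with * assms(5) show False
          by blast
      qed
    qed
    have "y < zpow \<tau> (1 + int n) x" if "x \<in> I" "y \<in> I" for x y
    proof (induction n)
      case 0
      then show ?case
        using up that assms(1) by simp
    next
      case (Suc n)
      have "y < \<tau> y"
        using up that by blast
      also have "\<dots> < \<tau> (zpow \<tau> (1 + int n) x)"
        using Suc assms(2) by (simp add: strict_mono_less)
      also have "\<dots> = zpow \<tau> (1 + int (Suc n)) x"
        using zpow_Suc(2)[OF assms(1), of "1 + int n" x] by (simp add: add_ac)
      finally show ?case .
    qed
    then show ?thesis
      by force
  next
    case False
    then have down: "\<tau> x < y" if "x \<in> I" "y \<in> I" for x y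
      using that assms(5) by (metis disjoint_iff imageI linorder_neqE)
    have "zpow \<tau> (1 + int n) x < y" if "x \<in> I" "y \<in> I" for x y
    proof (induction n)
      case 0
      then show ?case
        using down that assms(1) by simp
    next
      case (Suc n)
      have "zpow \<tau> (1 + int (Suc n)) x = \<tau> (zpow \<tau> (1 + int n) x)"
        using zpow_Suc(2)[OF assms(1), of "1 + int n" x] by (simp add: add_ac)
      also have "\<dots> < \<tau> y"
        using Suc assms(2) by (simp add: strict_mono_less)
      also have "\<dots> < y"
        using down that by blast
      finally show ?case .
    qed
    then show ?thesis
      by force
  qed
  show ?thesis
  proof (cases "p > 0")
    case True
    then show ?thesis
      using pos[of "nat (p - 1)"] by simp
  next
    case False
    with assms(6) have *: "zpow \<tau> (- p) ` I \<inter> I = {}"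
      using pos[of "nat (- p - 1)"] by simp
    \<comment> \<open>A point of \<open>I\<close> kept in \<open>I\<close> by the negative power
      \<open>p\<close> would be brought back into \<open>I\<close> by the positive power
      \<open>- p\<close>.\<close>
    have "zpow \<tau> p x \<notin> I" if "x \<in> I" for x
    proof
      assume "zpow \<tau> p x \<in> I"
      then have "zpow \<tau> (- p) (zpow \<tau> p x) \<in> zpow \<tau> (- p) ` I"
        by (rule imageI)
      with that * assms(1) show False
        by auto
    qed
    then show ?thesis
      by blast
  qed
qed


section \<open>The group of the construction\<close>

locale construction =
  fixes t :: "nat \<Rightarrow> real \<Rightarrow> real"
  assumes admissible: "admissible_choice t"
begin

abbreviation stage :: "nat \<Rightarrow> real set" where
  "stage \<equiv> stage_interval t"

abbreviation \<tau> :: "nat \<Rightarrow> real \<Rightarrow> real" where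
  "\<tau> n \<equiv> t (Suc n)"

lemma \<tau>_Homeo_c: "\<tau> n \<in> Homeo_c" and stage_Suc_connected: "connected (stage (Suc n))"
  and \<tau>_disjoint: "\<tau> n ` stage n \<inter> stage n = {}"
  using admissible by (auto simp: admissible_choice_def)

lemma bij_\<tau>: "bij (\<tau> n)"
  using \<tau>_Homeo_c[of n] homeomorphism_UNIV_bij unfolding Homeo_c_def by blast

text \<open>Since \<open>\<tau> n\<close> moves \<open>stage n\<close> off itself, it fixes no point
  there, and its support is the next stage.\<close>

lemma stage_mono: "m \<le> n \<Longrightarrow> stage m \<subseteq> stage n"
proof (rule lift_Suc_mono_le)
  show "stage n \<subseteq> stage (Suc n)" for n
    using \<tau>_disjoint[of n] by (auto simp: mem_supp)
qed

lemma stage_connected: "connected (stage n)"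
  using stage_Suc_connected by (cases n) auto

lemma stage_nonempty: "stage n \<noteq> {}"
proof -
  have "1 / 2 \<in> stage 0"
    by simp
  then show ?thesis
    using stage_mono[of 0 n] by blast
qed

lemma stage_translates_disjoint: "p \<noteq> 0 \<Longrightarrow> zpow (\<tau> n) p ` stage n \<inter> stage n = {}"
proof -
  have "continuous_on UNIV (\<tau> n)"
    using \<tau>_Homeo_c[of n] homeomorphism_cont1 unfolding Homeo_c_def by blast
  then show "p \<noteq> 0 \<Longrightarrow> zpow (\<tau> n) p ` stage n \<inter> stage n = {}"
    using translates_disjoint[OF bij_\<tau> Homeo_c_strict_mono[OF \<tau>_Homeo_c] _ stage_connected \<tau>_disjoint]
    by blast
qed

text \<open>The groups \<open>env n\<close> contain \<open>\<Gamma>\<^sub>n\<close> but forget continuity and everything about Thompson's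
  group except its germs at \<open>0\<close>; this avoids proving that \<^const>\<open>Thompson_F\<close> is a group.\<close>

primrec env :: "nat \<Rightarrow> (real \<Rightarrow> real) set" where
  "env 0 = germs"
| "env (Suc n) = wandering.wreath (stage n) (\<tau> n) (env n)"

text \<open>A homomorphism to the integers on each \<open>env n\<close>, extending the logarithmic
  slope at 0. It is the obstruction to writing \<open>seed\<close> as a commutator.\<close>

primrec character :: "nat \<Rightarrow> (real \<Rightarrow> real) \<Rightarrow> int" where
  "character 0 = slope_exponent"
| "character (Suc n) = wandering.total (stage n) (\<tau> n) (env n) (character n)"

text \<open>The locale at stage \<open>n\<close> requires \<open>env n\<close> to be a subgroup
  supported on \<open>stage n\<close>, and it yields the same facts for the next stage. The
  induction carries just these two.\<close>

lemma wandering_env: "wandering (stage n) (\<tau> n) (env n)"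
proof -
  have wandering: "wandering (stage n) (\<tau> n) (env n)"
    if "subgroup (env n) Sym" "\<And>g. g \<in> env n \<Longrightarrow> supp g \<subseteq> stage n" for n
    using that bij_\<tau> stage_nonempty stage_translates_disjoint by (simp add: wandering_def)
  have "subgroup (env n) Sym \<and> (\<forall>g\<in>env n. supp g \<subseteq> stage n)"
  proof (induction n)
    case 0
    then show ?case
      using subgroup_germs by (simp add: germs_def)
  next
    case (Suc n)
    then interpret wandering "stage n" "\<tau> n" "env n"
      using wandering by blast
    show ?case
      using subgroup_wreath by (simp add: wreath_def)
  qed
  with wandering show ?thesis
    by blast
qed

sublocale W: wandering "stage n" "\<tau> n" "env n" for n
  by (rule wandering_env)

lemma env_Suc: "env (Suc n) = W.wreath n"
  by simp

lemma env_mono: "m \<le> n \<Longrightarrow> env m \<subseteq> env n"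
  by (rule lift_Suc_mono_le) (simp_all add: W.E_subset_wreath)

lemma Gamma_subset_env: "stage_Gamma t n \<subseteq> env n"
proof (induction n)
  case 0
  then show ?case
    using Thompson_F_subset_germs by simp
next
  case (Suc n)
  then have "insert (\<tau> n) (stage_Gamma t n) \<subseteq> W.wreath n"
    using W.shift_in_wreath W.E_subset_wreath by blast
  then show ?case
    using group.generate_subgroup_incl[OF group_Sym _ W.subgroup_wreath] by simp
qed

lemma character_comp: "g \<in> env n \<Longrightarrow> h \<in> env n \<Longrightarrow> character n (g \<circ> h) = character n g + character n h"
proof (induction n arbitrary: g h)
  case 0
  then show ?case
    unfolding env.simps character.simps by (rule slope_exponent_comp)
next
  case (Suc n)
  then have "g \<in> W.wreath n" "h \<in> W.wreath n"
    by simp_all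
  then show ?case
    unfolding character.simps by (intro W.total_comp Suc.IH)
qed

lemma character_id: "character n id = 0"
  using character_comp[OF W.E_group(2) W.E_group(2), of n] by simp

text \<open>At every stage an element of \<open>env 0\<close> occupies only the coordinate of index
  0, so the sum reduces to that term.\<close>

lemma character_stable: "g \<in> env 0 \<Longrightarrow> character n g = slope_exponent g"
proof (induction n)
  case (Suc n)
  moreover have "g \<in> env n"
    using Suc.prems env_mono[of 0 n] by blast
  ultimately show ?case
    using W.total_base[of "character n" g n] character_id by simp
qed simp

text \<open>Elements of the stage directly above \<open>n\<close> permute the blocks. Higher up, a
  zero top shift leaves the action to an element one stage lower, while a nonzero one moves
  \<open>stage m\<close>, which contains \<open>stage (Suc n)\<close>, off itself.\<close>

lemma block_image:
  assumes "g \<in> env m" "n < m"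
  shows "g ` stage n \<inter> stage (Suc n) = {} \<or> (\<exists>k. g ` stage n = zpow (\<tau> n) k ` stage n)"
  using assms
proof (induction m arbitrary: g)
  case (Suc m)
  show ?case
  proof (cases "n = m")
    case True
    then show ?thesis
      using W.wreath_image_block[of g n] Suc.prems by auto
  next
    case False
    then have "n < m"
      using Suc.prems by simp
    then have sub: "stage n \<subseteq> stage m" "stage (Suc n) \<subseteq> stage m"
      using stage_mono[of n m] stage_mono[of "Suc n" m] by simp_all
    obtain k c where c: "c \<in> env m" and g: "\<And>x. x \<in> stage m \<Longrightarrow> g x = zpow (\<tau> m) k (c x)"
      using W.wreath_on_block[of g m] Suc.prems(1) unfolding env_Suc by blast
    show ?thesis
    proof (cases "k = 0")
      case True
      then have "g ` stage n = c ` stage n"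
        using g sub by (intro image_cong) auto
      with Suc.IH[OF c \<open>n < m\<close>] show ?thesis
        by simp
    next
      case False
      have "g ` stage n \<subseteq> zpow (\<tau> m) k ` stage m"
        using g sub W.E_maps[OF c] by blast
      with False stage_translates_disjoint[of k m] sub show ?thesis
        by blast
    qed
  qed
qed simp

section \<open>The group \<Gamma> as an increasing union\<close>

definition \<Gamma> :: "(real \<Rightarrow> real) set" where
  "\<Gamma> = (\<Union>n. stage_Gamma t n)"

lemma Gamma_group_eq: "Gamma_group t = Sym\<lparr>carrier := \<Gamma>\<rparr>"
  by (simp add: Gamma_group_def \<Gamma>_def)

lemma stage_Gamma_mono: "m \<le> n \<Longrightarrow> stage_Gamma t m \<subseteq> stage_Gamma t n"
  by (rule lift_Suc_mono_le) (auto intro: generate.incl)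

lemma stage_Gamma_bij: "g \<in> stage_Gamma t n \<Longrightarrow> bij g"
  using Gamma_subset_env W.E_group(1) by blast

lemma \<tau>_in_stage_Gamma: "\<tau> n \<in> stage_Gamma t (Suc n)"
  by (simp add: generate.incl)

lemma subgroup_stage_Gamma_Suc: "subgroup (stage_Gamma t (Suc n)) Sym"
  using group.generate_is_subgroup[OF group_Sym, of "insert (\<tau> n) (stage_Gamma t n)"] bij_\<tau> stage_Gamma_bij
  by (simp add: carrier_Sym subset_iff)

text \<open>The stages form a chain. A successor stage is taken so that
  \<open>subgroup_stage_Gamma_Suc\<close> applies to it.\<close>

lemma finite_subset_stage:
  assumes "finite S" "S \<subseteq> \<Gamma>"
  obtains n where "S \<subseteq> stage_Gamma t (Suc n)"
proof -
  from assms have "\<exists>n. S \<subseteq> stage_Gamma t n"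
  proof (induction S rule: finite_induct)
    case (insert x S)
    then obtain m n where "S \<subseteq> stage_Gamma t m" "x \<in> stage_Gamma t n"
      by (auto simp: \<Gamma>_def)
    then have "insert x S \<subseteq> stage_Gamma t (max m n)"
      using stage_Gamma_mono[of m "max m n"] stage_Gamma_mono[of n "max m n"] by auto
    then show ?case ..
  qed simp
  with that stage_Gamma_mono[OF le_SucI[OF order_refl]] show thesis
    by (meson order_trans)
qed

lemma subgroup_\<Gamma>: "subgroup \<Gamma> Sym"
proof (rule subgroup_SymI)
  have stage: "stage_Gamma t n \<subseteq> \<Gamma>" for n
    by (auto simp: \<Gamma>_def)
  show "bij f" if "f \<in> \<Gamma>" for f
    using that stage_Gamma_bij by (auto simp: \<Gamma>_def)
  show "id \<in> \<Gamma>"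
    using subgroup_SymD(2)[OF subgroup_stage_Gamma_Suc] stage by blast
  show "f \<circ> g \<in> \<Gamma>" if fg: "f \<in> \<Gamma>" "g \<in> \<Gamma>" for f g
  proof -
    obtain n where "{f, g} \<subseteq> stage_Gamma t (Suc n)"
      using finite_subset_stage[of "{f, g}"] fg by auto
    then show ?thesis
      using subgroup_SymD(3)[OF subgroup_stage_Gamma_Suc] stage by blast
  qed
  show "finv f \<in> \<Gamma>" if f: "f \<in> \<Gamma>" for f
  proof -
    obtain n where "{f} \<subseteq> stage_Gamma t (Suc n)"
      using finite_subset_stage[of "{f}"] f by auto
    then show ?thesis
      using subgroup_SymD(4)[OF subgroup_stage_Gamma_Suc] stage by blast
  qed
qed

lemmas \<Gamma>_bij = subgroup_SymD(1)[OF subgroup_\<Gamma>]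

sublocale G: group "Gamma_group t"
  unfolding Gamma_group_eq by (rule group.subgroup_imp_group[OF group_Sym subgroup_\<Gamma>])

lemma carrier_Gamma_group [simp]: "carrier (Gamma_group t) = \<Gamma>"
  by (simp add: Gamma_group_eq)

lemma mult_Gamma_group: "f \<in> \<Gamma> \<Longrightarrow> g \<in> \<Gamma> \<Longrightarrow> f \<otimes>\<^bsub>Gamma_group t\<^esub> g = f \<circ> g"
  by (simp add: Gamma_group_eq mult_Sym \<Gamma>_bij)

lemma inv_Gamma_group: "f \<in> \<Gamma> \<Longrightarrow> inv\<^bsub>Gamma_group t\<^esub> f = finv f"
  using group.m_inv_consistent[OF group_Sym subgroup_\<Gamma>] by (simp add: Gamma_group_eq inv_Sym \<Gamma>_bij)

lemma pow_Gamma_group: "f \<in> \<Gamma> \<Longrightarrow> f [^]\<^bsub>Gamma_group t\<^esub> (p :: int) = zpow f p"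
  using group.int_pow_consistent[OF group_Sym subgroup_\<Gamma>] by (simp add: Gamma_group_eq)

lemma conj_by_Gamma_group: "f \<in> \<Gamma> \<Longrightarrow> g \<in> \<Gamma> \<Longrightarrow> conj_by (Gamma_group t) f g = f \<circ> g \<circ> finv f"
  using subgroup_SymD(3,4)[OF subgroup_\<Gamma>] by (simp add: conj_by_def mult_Gamma_group inv_Gamma_group)

lemma seed_in_Gamma: "seed \<in> stage_Gamma t n"
  using seed_in_Thompson_F stage_Gamma_mono[of 0 n] by auto

lemma \<tau>_in_\<Gamma>: "\<tau> n \<in> \<Gamma>" and seed_in_\<Gamma>: "seed \<in> \<Gamma>"
  unfolding \<Gamma>_def using \<tau>_in_stage_Gamma seed_in_Gamma by blast+

text \<open>Applying \<open>character\<close> to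
  \<open>g \<circ> f = (seed \<circ> f) \<circ> g\<close> gives \<open>seed\<close> the value 0, but
  its value is its slope exponent \<open>- 1\<close>.\<close>

lemma seed_not_commutator:
  assumes "f \<in> \<Gamma>" "g \<in> \<Gamma>"
  shows "conj_by (Gamma_group t) g f \<noteq> seed \<otimes>\<^bsub>Gamma_group t\<^esub> f"
proof
  assume "conj_by (Gamma_group t) g f = seed \<otimes>\<^bsub>Gamma_group t\<^esub> f"
  then have "g \<circ> f = (seed \<circ> f) \<circ> g"
    using G.conj_by_eq_iff[of g f "seed \<otimes>\<^bsub>Gamma_group t\<^esub> f"] assms seed_in_\<Gamma>
      subgroup_SymD(3)[OF subgroup_\<Gamma> seed_in_\<Gamma> assms(1)] by (simp add: mult_Gamma_group)
  moreover obtain n where "{f, g} \<subseteq> stage_Gamma t (Suc n)"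
    using finite_subset_stage[of "{f, g}"] assms by auto
  then have fg: "f \<in> env (Suc n)" "g \<in> env (Suc n)" "seed \<in> env (Suc n)"
    using Gamma_subset_env[of "Suc n"] seed_in_Gamma[of "Suc n"] by blast+
  moreover have "seed \<circ> f \<in> env (Suc n)"
    using fg W.E_group(3) by blast
  ultimately have "character (Suc n) seed = 0"
    using character_comp[of _ "Suc n"] by (metis add.commute add_cancel_right_left add_left_cancel)
  moreover have "seed \<in> env 0"
    using seed_in_Thompson_F Thompson_F_subset_germs by auto
  then have "character (Suc n) seed = - 1"
    using character_stable slope_exponent_seed by presburger
  ultimately show False
    by simp
qed

text \<open>A finitely generated subgroup lies in one stage and is supported on its interval, which
  every positive power of the next translating element moves off itself.\<close>

lemma Gamma_group_commuting_Z_conjugates: "commuting_Z_conjugates (Gamma_group t)"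
  unfolding commuting_Z_conjugates_def
proof (intro allI impI)
  fix H assume "fin_gen_subgroup H (Gamma_group t)"
  then obtain S where S: "finite S" "S \<subseteq> \<Gamma>" and H: "H = generate (Gamma_group t) S"
    unfolding fin_gen_subgroup_def by auto
  then obtain n where n: "S \<subseteq> stage_Gamma t (Suc n)"
    using finite_subset_stage by blast
  let ?n = "Suc n"
  have H_\<Gamma>: "H \<subseteq> \<Gamma>"
    using G.generate_incl[of S] S by (simp add: H)
  have "H = generate Sym S"
    using group.generate_consistent[OF group_Sym S(2) subgroup_\<Gamma>] by (simp add: H Gamma_group_eq)
  then have "H \<subseteq> {g. bij g \<and> supp g \<subseteq> stage ?n}"
    using group.generate_subgroup_incl[OF group_Sym _ subgroup_supported] n Gamma_subset_env[of ?n]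
      W.supported[of _ ?n] W.E_group(1)[of _ ?n] by (metis (mono_tags, lifting) mem_Collect_eq subset_iff)
  then have supp_H: "supp h \<subseteq> stage ?n" if "h \<in> H" for h
    using that by blast
  show "\<exists>u\<in>carrier (Gamma_group t). \<forall>p::int. p \<ge> 1 \<longrightarrow>
      commutator_subgroup (Gamma_group t) H (conj_by (Gamma_group t) (u [^]\<^bsub>Gamma_group t\<^esub> p) ` H) =
        {\<one>\<^bsub>Gamma_group t\<^esub>}"
  proof (intro bexI[of _ "\<tau> ?n"] allI impI)
    fix p :: int assume "p \<ge> 1"
    let ?z = "zpow (\<tau> ?n) p"
    have z: "?z \<in> \<Gamma>"
      using G.int_pow_closed[of "\<tau> ?n" p] \<tau>_in_\<Gamma> by (simp add: pow_Gamma_group)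
    have "conj_by (Gamma_group t) ?z ` H \<subseteq> \<Gamma>"
      using G.conj_by_closed[of ?z] z H_\<Gamma> by auto
    moreover have "h \<otimes>\<^bsub>Gamma_group t\<^esub> conj_by (Gamma_group t) ?z k =
        conj_by (Gamma_group t) ?z k \<otimes>\<^bsub>Gamma_group t\<^esub> h" if hk: "h \<in> H" "k \<in> H" for h k
    proof -
      have \<Gamma>: "h \<in> \<Gamma>" "k \<in> \<Gamma>"
        using hk H_\<Gamma> by blast+
      let ?k = "?z \<circ> k \<circ> finv ?z"
      have k: "?k \<in> \<Gamma>"
        using \<Gamma> z subgroup_SymD(3,4)[OF subgroup_\<Gamma>] by blast
      have "h \<circ> ?k = ?k \<circ> h"
      proof (rule disjoint_supp_commute)
        show "bij h" "bij ?k"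
          using \<Gamma> k \<Gamma>_bij by blast+
        show "supp h \<subseteq> stage ?n" "supp ?k \<subseteq> ?z ` stage ?n"
          using hk supp_H supp_conj[OF \<Gamma>_bij[OF z]] by blast+
        show "stage ?n \<inter> ?z ` stage ?n = {}"
          using stage_translates_disjoint[of p ?n] \<open>p \<ge> 1\<close> by (simp add: Int_commute)
      qed
      with \<Gamma> z k show ?thesis
        by (simp add: conj_by_Gamma_group mult_Gamma_group)
    qed
    ultimately show "commutator_subgroup (Gamma_group t) H
        (conj_by (Gamma_group t) (\<tau> ?n [^]\<^bsub>Gamma_group t\<^esub> p) ` H) = {\<one>\<^bsub>Gamma_group t\<^esub>}"
      using H_\<Gamma> \<tau>_in_\<Gamma>[of ?n]
      by (subst commutator_subgroup_trivial_iff[OF G.is_group]) (auto simp: pow_Gamma_group)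
  qed (simp add: \<tau>_in_\<Gamma>)
qed

text \<open>In the block case, the commutator \<open>w\<close> of \<open>v\<close> and
  \<open>\<tau> n\<close> is supported on two neighbouring blocks. It commutes with
  \<open>\<tau> n\<close>, so its support is invariant; but the square of \<open>\<tau> n\<close>
  moves these two blocks off themselves. Hence \<open>w\<close> is trivial.\<close>

lemma commuting_conjugate_eq:
  assumes v: "bij v" "supp v \<subseteq> J" and J: "J \<inter> stage (Suc n) = {} \<or> J = zpow (\<tau> n) k ` stage n"
    and comm: "\<tau> n \<circ> (v \<circ> \<tau> n \<circ> finv v) = (v \<circ> \<tau> n \<circ> finv v) \<circ> \<tau> n"
  shows "v \<circ> \<tau> n = \<tau> n \<circ> v"
proof (cases "J \<inter> stage (Suc n) = {}")
  case True
  then show ?thesis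
    using v by (intro disjoint_supp_commute[OF _ bij_\<tau>]) auto
next
  case False
  then have J: "J = zpow (\<tau> n) k ` stage n"
    using J by blast
  let ?s = "\<tau> n"
  \<comment> \<open>Bracketed as \<open>v\<close> times a conjugate of its inverse, so that the two
    supports can be bounded separately.\<close>
  define w where "w = v \<circ> (?s \<circ> finv v \<circ> finv ?s)"
  have s_inv: "finv ?s (?s x) = x" "?s (finv ?s x) = x" for x
    using bij_\<tau>[of n] by (simp_all add: bij_is_inj bij_is_surj surj_f_inv_f)
  have v_inv: "finv v (v x) = x" "v (finv v x) = x" for x
    using v(1) by (simp_all add: bij_is_inj bij_is_surj surj_f_inv_f)
  \<comment> \<open>This is \<open>comm\<close> composed on the right with the inverse of
    \<open>\<tau> n\<close>.\<close>
  have w_s: "w (?s x) = ?s (w x)" for x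
    using fun_cong[OF comm, of "finv ?s x"] by (simp add: w_def s_inv)
  have s_J: "?s ` zpow ?s k ` A = zpow ?s (k + 1) ` A" for k A
    using zpow_Suc(2)[OF bij_\<tau>, of n k] by (force simp: add.commute image_iff)
  have conj_s: "supp (?s \<circ> finv v \<circ> finv ?s) \<subseteq> ?s ` J"
    using supp_conj[OF bij_\<tau> supp_inv[OF v]] .
  have supp_w: "supp w \<subseteq> zpow ?s k ` stage n \<union> zpow ?s (k + 1) ` stage n"
    unfolding w_def s_J[symmetric] J[symmetric] by (rule supp_comp) (use v(2) conj_s in blast)+
  have "w x = x" for x
  proof (rule ccontr)
    assume "w x \<noteq> x"
    moreover from this have "w (?s (?s x)) \<noteq> ?s (?s x)"
      using w_s bij_\<tau>[of n] by (simp add: bij_is_inj inj_eq)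
    ultimately have x: "x \<in> zpow ?s k ` stage n \<union> zpow ?s (k + 1) ` stage n"
      and ssx: "?s (?s x) \<in> zpow ?s k ` stage n \<union> zpow ?s (k + 1) ` stage n"
      using supp_w unfolding mem_supp[symmetric] by blast+
    from x have "?s (?s x) \<in> zpow ?s (k + 1 + 1) ` stage n \<union> zpow ?s (k + 1 + 1 + 1) ` stage n"
      unfolding s_J[symmetric] by blast
    moreover have "zpow ?s p ` stage n \<inter> zpow ?s q ` stage n = {}"
      if "p \<in> {k, k + 1}" "q \<in> {k + 1 + 1, k + 1 + 1 + 1}" for p q
      using that by (intro W.disjoint_translates) auto
    ultimately show False
      using ssx by blast
  qed
  then have "v (?s y) = ?s (v y)" for y
    using w_def v_inv s_inv by (metis comp_apply)
  then show ?thesis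
    by auto
qed

text \<open>The order of choices matters: \<open>u\<close> determines the stage \<open>n\<close>,
  and only then is the finite set of \<open>\<tau> n\<close> and \<open>seed\<close> put into a
  conjugate of \<Lambda>. There \<open>v\<close> takes over the role of \<open>u\<close>.\<close>

lemma Gamma_group_no_conjugates_in_commuting_Z_conjugate:
  "\<not> conjugates_in_commuting_Z_conjugate (Gamma_group t)"
proof
  let ?G = "Gamma_group t"
  assume "conjugates_in_commuting_Z_conjugate ?G"
  then obtain \<Lambda> u where \<Lambda>: "subgroup \<Lambda> ?G" and u: "u \<in> \<Gamma>"
    and comm: "\<And>p::int. p \<ge> 1 \<Longrightarrow>
      commutator_subgroup ?G \<Lambda> (conj_by ?G (u [^]\<^bsub>?G\<^esub> p) ` \<Lambda>) = {\<one>\<^bsub>?G\<^esub>}"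
    and conj: "\<And>F. finite F \<Longrightarrow> F \<subseteq> \<Gamma> \<Longrightarrow> \<exists>g\<in>\<Gamma>. F \<subseteq> conj_by ?G g ` \<Lambda>"
    unfolding conjugates_in_commuting_Z_conjugate_def carrier_Gamma_group by metis
  have \<Lambda>_\<Gamma>: "\<Lambda> \<subseteq> \<Gamma>"
    using subgroup.subset[OF \<Lambda>] by simp
  have "conj_by ?G u ` \<Lambda> \<subseteq> \<Gamma>"
    using G.conj_by_closed[of u] u \<Lambda>_\<Gamma> by auto
  then have comm_u: "\<forall>a\<in>\<Lambda>. \<forall>b\<in>conj_by ?G u ` \<Lambda>. a \<otimes>\<^bsub>?G\<^esub> b = b \<otimes>\<^bsub>?G\<^esub> a"
    using comm[of 1] u \<Lambda>_\<Gamma> commutator_subgroup_trivial_iff[OF G.is_group, of \<Lambda> "conj_by ?G u ` \<Lambda>"]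
    by simp
  obtain n' where n': "{u} \<subseteq> stage_Gamma t (Suc n')"
    using finite_subset_stage[of "{u}"] u by auto
  define n where "n = Suc n'"
  have u_env: "u \<in> env n"
    using n' Gamma_subset_env[of n] by (auto simp: n_def)
  obtain g where g: "g \<in> \<Gamma>" and F: "{\<tau> n, seed} \<subseteq> conj_by ?G g ` \<Lambda>"
    using conj[of "{\<tau> n, seed}"] \<tau>_in_\<Gamma> seed_in_\<Gamma> by auto
  define v where "v = conj_by ?G g u"
  have v: "v \<in> \<Gamma>" "v = g \<circ> u \<circ> finv g"
    using G.conj_by_closed[of g u] g u by (simp_all add: v_def conj_by_Gamma_group)
  have comm_v: "a \<circ> (v \<circ> \<tau> n \<circ> finv v) = (v \<circ> \<tau> n \<circ> finv v) \<circ> a" if a: "a \<in> {\<tau> n, seed}" for a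
  proof -
    obtain a' s where *: "a' \<in> \<Lambda>" "a = conj_by ?G g a'" "s \<in> \<Lambda>" "\<tau> n = conj_by ?G g s"
      using F a by blast
    then have "a \<otimes>\<^bsub>?G\<^esub> conj_by ?G v (\<tau> n) = conj_by ?G v (\<tau> n) \<otimes>\<^bsub>?G\<^esub> a"
      using G.commute_conj_by[of g u a' s] g u \<Lambda>_\<Gamma> comm_u unfolding v_def by auto
    moreover have "a \<in> \<Gamma>" "conj_by ?G v (\<tau> n) \<in> \<Gamma>"
      using a \<tau>_in_\<Gamma> seed_in_\<Gamma> G.conj_by_closed[of v "\<tau> n"] v by auto
    ultimately show ?thesis
      using v \<tau>_in_\<Gamma> by (simp add: mult_Gamma_group conj_by_Gamma_group)
  qed
  obtain m' where m': "g \<in> stage_Gamma t m'"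
    using g by (auto simp: \<Gamma>_def)
  \<comment> \<open>The maximum is a stage containing \<open>g\<close> and strictly above
    \<open>n\<close>, as \<open>block_image\<close> requires.\<close>
  then have "g \<in> env (max m' (Suc n))"
    using Gamma_subset_env env_mono[of m' "max m' (Suc n)"] by auto
  then have "g ` stage n \<inter> stage (Suc n) = {} \<or> (\<exists>k. g ` stage n = zpow (\<tau> n) k ` stage n)"
    by (rule block_image) simp
  moreover have "supp v \<subseteq> g ` stage n"
    unfolding v(2) using supp_conj[OF \<Gamma>_bij[OF g] W.supported[OF u_env]] .
  ultimately have v_\<tau>: "v \<circ> \<tau> n = \<tau> n \<circ> v"
    using commuting_conjugate_eq[OF \<Gamma>_bij[OF v(1)]] comm_v by blast
  have "v \<circ> \<tau> n \<circ> finv v = \<tau> n"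
    unfolding v_\<tau> using \<Gamma>_bij[OF v(1)] by (simp add: fun_eq_iff bij_is_surj surj_f_inv_f)
  \<comment> \<open>The conjugate of \<open>\<tau> n\<close> by \<open>v\<close> is now
    \<open>\<tau> n\<close> itself, so \<open>comm_v\<close> for \<open>seed\<close> becomes
    commutation with \<open>\<tau> n\<close>.\<close>
  then have seed_\<tau>: "seed (\<tau> n x) = \<tau> n (seed x)" for x
    using comm_v[of seed] by (metis comp_apply insertI1 insert_commute)
  \<comment> \<open>A point moved by \<open>seed\<close>. Its image under \<open>\<tau> n\<close>
    lies outside \<open>stage n\<close> and is therefore fixed by \<open>seed\<close>, contrary to
    commutation.\<close>
  define x :: real where "x = 1 / 4"
  have x: "seed x \<noteq> x"
    by (simp add: seed_eq x_def)
  have "supp seed \<subseteq> stage n"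
    using seed_in_Gamma[of n] Gamma_subset_env W.supported by blast
  moreover from this x have "\<tau> n x \<notin> stage n"
    using \<tau>_disjoint[of n] by (auto simp: subset_iff mem_supp)
  ultimately have "\<tau> n x \<notin> supp seed"
    by blast
  with x seed_\<tau> show False
    using bij_\<tau>[of n] by (simp add: mem_supp bij_is_inj inj_eq)
qed

end

theorem proposition3p15:
  fixes t :: "nat \<Rightarrow> real \<Rightarrow> real"
  assumes "admissible_choice t"
  shows "commuting_Z_conjugates (Gamma_group t) \<and>
         \<not> dissipated TYPE('x) TYPE('i) (Gamma_group t) \<and>
         \<not> binate (Gamma_group t) \<and>
         \<not> conjugates_in_commuting_Z_conjugate (Gamma_group t)"
proof -
  interpret construction t
    by unfold_locales (rule assms)
  have seed: "seed \<in> carrier (Gamma_group t)"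
    by (simp add: seed_in_\<Gamma>)
  have "\<not> dissipated TYPE('x) TYPE('i) (Gamma_group t)"
    using dissipated_commutator[OF G.is_group _ seed] seed_not_commutator by (metis carrier_Gamma_group)
  moreover have "\<not> binate (Gamma_group t)"
    using binate_commutator[OF G.is_group _ seed] seed_not_commutator by (metis carrier_Gamma_group)
  ultimately show ?thesis
    using Gamma_group_commuting_Z_conjugates Gamma_group_no_conjugates_in_commuting_Z_conjugate
    by blast
qed

end
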